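(* Let $\varphi^\flat$ be a kinetic function satisfying (A1)--(A3) (recalled in the context). Consider the weighted interaction functional $$Q_{\text{pos}}(u(t))=\sum_{x<y}\theta(x,y)\,\sigma(x)\,\sigma(y)$$ evaluated for a front-tracking approximate solution $u$ to $u_t+f(u)_x=0$, whose nonclassical discontinuities satisfy the kinetic relation $u_+=\varphi^\flat(u_-)$, and with initial data $u_0\in\mathrm{BV}(\mathbb{R})$. If the constant $C_*>0$ entering the weight $\theta$ is taken sufficiently small, then $Q_{\text{pos}}$ is strictly decreasing during all interactions except in the cases RC-3, CR-4, CC-3 and CN-3, which involve a small wave interacting with a crossing shock.
   Context: **Flux and entropy.** $f:\mathbb{R}\to\mathbb{R}$ is smooth and concave-convex: $u f''(u)>0$ for $u\ne0$, $f'''(0)\neq 0$, $\lim_{|u|\to\infty}f'(u)=+\infty$. $U$ is a given strictly convex entropy, $F(u)=\int^uU'(v)f'(v)\,dv$. **Zero-dissipation function.** $\varphi_0^\flat:\mathbb{R}\to\mathbb{R}$ is determined by $f,U$: $\varphi_0^\flat(0)=0$ and, for $u\ne0$, $v=\varphi_0^\flat(u)\neq u$ is the value with $-s\,(U(v)-U(u))+F(v)-F(u)=0$, $s=\frac{f(v)-f(u)}{v-u}$. It is Lipschitz, decreasing, and $\varphi_0^\flat\circ\varphi_0^\flat(u)=u$. **Kinetic function.** $\varphi^\flat:\mathbb{R}\to\mathbb{R}$ satisfies: (A1) it is Lipschitz continuous and one-to-one; (A2) $\partial_u\varphi^\flat(u)<0$ for all $u$, $\varphi^\flat(0)=0$;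 (A3) $\varphi^\flat\circ\varphi^\flat$ is a strict contraction, i.e. for some $K\in(0,1)$, $|\varphi^\flat\circ\varphi^\flat(u)|\le K|u|$ for $u\ne0$. Standing facts of the theory, assumed throughout: $|\varphi^\flat(u)|<|\varphi^\flat_0(u)|$ for $u\neq0$; on bounded sets the function $u-\varphi_0^\flat\circ\varphi^\flat(u)$ has a positive lower Lipschitz constant. The threshold $\varphi^\sharp(u)\notin\{u,\varphi^\flat(u)\}$ is the unique value with $\frac{f(u)-f(\varphi^\flat(u))}{u-\varphi^\flat(u)}=\frac{f(u)-f(\varphi^\sharp(u))}{u-\varphi^\sharp(u)}$; for $u>0$, $\varphi^\flat(u)<\varphi^\sharp(u)<u$ (reversed for $u<0$). **Nonclassical Riemann solver** with left state $u_l>0$ and right state $u_r$: a rarefaction if $u_r\ge u_l$; a classical shock if $\varphi^\sharp(u_l)\le u_r<u_l$; a nonclassical shock from $u_l$ to $\varphi^\flat(u_l)$ followed by a classical shock from $\varphi^\flat(u_l)$ to $u_r$ if $\varphi^\flat(u_l)<u_r<\varphi^\sharp(u_l)$; a nonclassical shock from $u_l$ to $\varphi^\flat(u_l)$ followed by a rarefaction from $\varphi^\flat(u_l)$ to $u_r$ if $u_r\le\varphi^\flat(u_l)$. For $u_l<0$ the solver is the same with all inequalities reversed. **Generalized strength** of a wave $(u_-,u_+)$: if $u_-\ge0$, $\sigma(u_-,u_+)=|u_--u_+|$ when $u_+\ge0$ and $|u_--\varphi_0^\flat(u_+)|$ when $u_+<0$; if $u_-<0$, $\sigma(u_-,u_+)=|\varphi_0^\flat(u_-)-\varphi_0^\flat(u_+)|$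 when $u_+<0$ and $|\varphi_0^\flat(u_-)-u_+|$ when $u_+\ge0$. **Front-tracking approximations (Dafermos).** The initial data is replaced by a piecewise constant function with finitely many jumps, within $\epsilon$ in $L^1$; Riemann problems are solved by the nonclassical solver, with each rarefaction replaced by a sequence of small discontinuities of strength $\sigma<\epsilon$; discontinuities propagate with Rankine–Hugoniot speed; when two discontinuities meet, the nonclassical Riemann solver is applied, outgoing rarefactions again being discontinuities. **The functional.** $\sigma(x)=\sigma(S)$ if a wave $S$ is located at $x$ and $\sigma(x)=0$ if no wave is located at $x$. For a wave at $x$ with left and right states $u_x^-,u_x^+$ set $\widehat u_x^\pm=u_x^\pm$ if $u_x^\pm\ge0$ and $\widehat u_x^\pm=\varphi_0^\flat(u_x^\pm)$ if $u_x^\pm<0$, and define the normalized speed $\widehat a(x)=\frac{f(\widehat u_x^+)-f(\widehat u_x^-)}{\widehat u_x^+-\widehat u_x^-}$. Two waves have the same monotonicity if, after mapping all states to the positive region by $u\mapsto\widehat u$, they are either both increasing or both decreasing. With $(k)^+=\max\{k,0\}$ and a constant $C_*>0$, $$\theta(x,y)=\begin{cases}C_*\,(\widehat a(x)-\widehat a(y))^+,&\text{if the waves at } x,y \text{ have the same monotonicity},\\1,&\text{otherwise.}\end{cases}$$ **Wave types.** $C_+^\downarrow$, $R_+^\uparrow$: classical shock, rarefaction between two nonnegative states; $C_-^\uparrow$, $R_-^\downarrow$: classical shock, rarefaction between two nonpositive states; $C_\pm^\downarrow$, $N_\pm^\downarrow$: classical, nonclassical shock from a positive to a negative state; $C_\mp^\uparrow$,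 $N_\mp^\uparrow$: classical, nonclassical shock from a negative to a positive state. $C^\downarrow$ stands for $C_+^\downarrow$ or $C_\pm^\downarrow$, and $C^\uparrow$ for $C_-^\uparrow$ or $C_\mp^\uparrow$, depending on the sign of the right state. Shocks between states of opposite signs are called crossing shocks. **Interactions.** The incoming left wave connects $u_l,u_m$, the incoming right wave connects $u_m,u_r$; primes denote outgoing waves. For $u_l>0$ (the cases for $u_l<0$ are the mirror images) the possible interactions are: - RC-1: $(R_+^\uparrow C^\downarrow)\to(C^{\downarrow\prime})$: $\max(\varphi^\sharp(u_l),\varphi^\sharp(u_m))<u_r<u_l$, $0<u_l<u_m$. - RC-2: $(R_+^\uparrow C_\pm^\downarrow)\to(N_\pm^{\downarrow\prime}R_-^{\downarrow\prime})$: $\varphi^\sharp(u_m)<u_r\le\varphi^\flat(u_l)<0<u_l<u_m$. - RC-3: $(R_+^\uparrow C^\downarrow)\to(N_\pm^{\downarrow\prime}C^{\uparrow\prime})$: $\max(\varphi^\flat(u_l),\varphi^\sharp(u_m))<u_r<\varphi^\sharp(u_l)$, $0<u_l<u_m$. - RN: $(R_+^\uparrow N_\pm^\downarrow)\to(N_\pm^{\downarrow\prime}R_-^{\downarrow\prime})$: $0<u_l<u_m$, $u_r=\varphi^\flat(u_m)$. - CR-1: $(C_\pm^\downarrow R_-^\downarrow)\to(C_\pm^{\downarrow\prime})$: $\varphi^\sharp(u_l)<u_r<u_m\le0<u_l$. - CR-2: $(C_+^\downarrow R_+^\uparrow)\to(C_+^{\downarrow\prime})$: $0\le u_m<u_r<u_l$.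 - CR-3: $(C_\pm^\downarrow R_-^\downarrow)\to(N_\pm^{\downarrow\prime}R_-^{\downarrow\prime})$: $u_r\le\varphi^\flat(u_l)<\varphi^\sharp(u_l)<u_m\le0<u_l$. - CR-4: $(C_\pm^\downarrow R_-^\downarrow)\to(N_\pm^{\downarrow\prime}C_-^{\uparrow\prime})$: $\varphi^\flat(u_l)<u_r<\varphi^\sharp(u_l)<u_m\le0<u_l$. - CC-1: $(C_+^\downarrow C^\downarrow)\to(C^{\downarrow\prime})$: $\max(\varphi^\sharp(u_l),\varphi^\sharp(u_m))<u_r<u_m<u_l$, $0\le u_m$. - CC-2: $(C_\pm^\downarrow C^\uparrow)\to(C^{\downarrow\prime})$: $\varphi^\sharp(u_l)<u_m<u_r<\varphi^\sharp(u_m)<u_l$, $u_m<0$. - CC-3: $(C_+^\downarrow C^\downarrow)\to(N_\pm^{\downarrow\prime}C^{\uparrow\prime})$: $\varphi^\flat(u_l)<\varphi^\sharp(u_m)<u_r<\varphi^\sharp(u_l)<u_m<u_l$, $0\le u_m$. - CN-1: $(C_+^\downarrow N_\pm^\downarrow)\to(C_\pm^{\downarrow\prime})$: $0<u_m<u_l$, $\varphi^\sharp(u_l)\le u_r=\varphi^\flat(u_m)$. - CN-2: $(C_\pm^\downarrow N_\mp^\uparrow)\to(C_+^{\downarrow\prime})$: $\varphi^\sharp(u_l)<u_m<0$, $u_r=\varphi^\flat(u_m)$. - CN-3: $(C_+^\downarrow N_\pm^\downarrow)\to(N_\pm^{\downarrow\prime}C_-^{\uparrow\prime})$: $0<u_m<u_l$,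 $u_r=\varphi^\flat(u_m)<\varphi^\sharp(u_l)$. - NC: $(N_\pm^\downarrow C^\uparrow)\to(C^{\downarrow\prime})$: $u_m=\varphi^\flat(u_l)$, $\varphi^\sharp(u_l)<u_r<\varphi^\sharp(u_m)<u_l$. - NN: $(N_\pm^\downarrow N_\mp^\uparrow)\to(C_+^{\downarrow\prime})$: $u_m=\varphi^\flat(u_l)$, $u_r=\varphi^\flat(u_m)$.
   Formalization: For the mirror images (u_l<0) of RC-2 and RN, φ_0^♭(u)−φ^♭(u) is also assumed to have a positive lower Lipschitz constant on bounded sets of u≤0 (the claim fails otherwise); the excepted cases include borderline states such as u_r=φ^♯(u_m); C_* depends on a sup bound of the initial data. *)

theory Defs
  imports "HOL-Analysis.Analysis"
begin

section \<open>Flux, entropy and kinetic function\<close>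

definition smooth :: "(real \<Rightarrow> real) \<Rightarrow> bool" where
  "smooth f \<longleftrightarrow> (\<forall>n x. (deriv ^^ n) f differentiable (at x))"

definition concave_convex_flux :: "(real \<Rightarrow> real) \<Rightarrow> bool" where
  "concave_convex_flux f \<longleftrightarrow>
     smooth f \<and> (\<forall>u. u \<noteq> 0 \<longrightarrow> u * (deriv ^^ 2) f u > 0) \<and> (deriv ^^ 3) f 0 \<noteq> 0 \<and>
     filterlim (deriv f) at_top at_infinity"

definition strictly_convex :: "(real \<Rightarrow> real) \<Rightarrow> bool" where
  "strictly_convex U \<longleftrightarrow>
     (\<forall>x y t. x \<noteq> y \<longrightarrow> 0 < t \<longrightarrow> t < 1 \<longrightarrow>
        U ((1 - t) * x + t * y) < (1 - t) * U x + t * U y)"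

text \<open>The entropy flux \<open>F\<close> is any antiderivative of \<open>U' f'\<close>; only differences of \<open>F\<close> matter.\<close>

definition entropy_pair :: "(real \<Rightarrow> real) \<Rightarrow> (real \<Rightarrow> real) \<Rightarrow> (real \<Rightarrow> real) \<Rightarrow> bool" where
  "entropy_pair f U F \<longleftrightarrow>
     strictly_convex U \<and> (\<forall>u. U differentiable (at u)) \<and>
     (\<forall>u. (F has_real_derivative deriv U u * deriv f u) (at u))"

definition chord :: "(real \<Rightarrow> real) \<Rightarrow> real \<Rightarrow> real \<Rightarrow> real" where
  "chord f u v = (f v - f u) / (v - u)"

definition zero_dissipation_function ::
  "(real \<Rightarrow> real) \<Rightarrow> (real \<Rightarrow> real) \<Rightarrow> (real \<Rightarrow> real) \<Rightarrow> (real \<Rightarrow> real) \<Rightarrow> bool" where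
  "zero_dissipation_function f U F \<phi>0 \<longleftrightarrow>
     \<phi>0 0 = 0 \<and>
     (\<forall>u v. u \<noteq> 0 \<longrightarrow>
        (v \<noteq> u \<and> - chord f u v * (U v - U u) + F v - F u = 0 \<longleftrightarrow> v = \<phi>0 u)) \<and>
     (\<exists>L. L-lipschitz_on UNIV \<phi>0) \<and>
     (\<forall>u v. u < v \<longrightarrow> \<phi>0 v < \<phi>0 u) \<and>
     (\<forall>u. \<phi>0 (\<phi>0 u) = u)"

text \<open>Properties (A1)--(A3).\<close>

definition kinetic_function :: "(real \<Rightarrow> real) \<Rightarrow> bool" where
  "kinetic_function \<phi>b \<longleftrightarrow>
     (\<exists>L. L-lipschitz_on UNIV \<phi>b) \<and> inj \<phi>b \<and>
     (\<forall>u. \<phi>b differentiable (at u) \<and> deriv \<phi>b u < 0) \<and> \<phi>b 0 = 0 \<and>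
     (\<exists>K. 0 < K \<and> K < 1 \<and> (\<forall>u. u \<noteq> 0 \<longrightarrow> \<bar>\<phi>b (\<phi>b u)\<bar> \<le> K * \<bar>u\<bar>))"

definition lower_lipschitz_on_bounded :: "real set \<Rightarrow> (real \<Rightarrow> real) \<Rightarrow> bool" where
  "lower_lipschitz_on_bounded A h \<longleftrightarrow>
     (\<forall>S. S \<subseteq> A \<longrightarrow> bounded S \<longrightarrow> (\<exists>c>0. \<forall>x\<in>S. \<forall>y\<in>S. c * \<bar>x - y\<bar> \<le> \<bar>h x - h y\<bar>))"

text \<open>The value of the threshold function \<open>\<phi>s\<close> at \<open>0\<close> is left open and plays no role.\<close>

definition threshold_function ::
  "(real \<Rightarrow> real) \<Rightarrow> (real \<Rightarrow> real) \<Rightarrow> (real \<Rightarrow> real) \<Rightarrow> bool" where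
  "threshold_function f \<phi>b \<phi>s \<longleftrightarrow>
     (\<forall>u v. u \<noteq> 0 \<longrightarrow>
        (v \<notin> {u, \<phi>b u} \<and> chord f u (\<phi>b u) = chord f u v \<longleftrightarrow> v = \<phi>s u)) \<and>
     (\<forall>u>0. \<phi>b u < \<phi>s u \<and> \<phi>s u < u) \<and>
     (\<forall>u<0. u < \<phi>s u \<and> \<phi>s u < \<phi>b u)"


section \<open>Waves and the nonclassical Riemann solver\<close>

datatype wave_kind = Rarefaction | Classical | Nonclassical

datatype wave = Wave (kind: wave_kind) (lstate: real) (rstate: real)

definition mirror :: "(real \<Rightarrow> real) \<Rightarrow> real \<Rightarrow> real" where
  "mirror \<phi> u = - \<phi> (- u)"

fun mirror_wave :: "wave \<Rightarrow> wave" where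
  "mirror_wave (Wave k a b) = Wave k (- a) (- b)"

definition riemann_nonneg ::
  "(real \<Rightarrow> real) \<Rightarrow> (real \<Rightarrow> real) \<Rightarrow> real \<Rightarrow> real \<Rightarrow> wave list" where
  "riemann_nonneg \<phi>b \<phi>s ul ur =
     (if ul \<le> ur then [Wave Rarefaction ul ur]
      else if ur \<le> \<phi>b ul then [Wave Nonclassical ul (\<phi>b ul), Wave Rarefaction (\<phi>b ul) ur]
      else if ur < \<phi>s ul then [Wave Nonclassical ul (\<phi>b ul), Wave Classical (\<phi>b ul) ur]
      else [Wave Classical ul ur])"

text \<open>
  Trivial waves are dropped. A left state \<open>0\<close> gives a single rarefaction, on either side of \<open>0\<close>:
  for \<open>ur < 0 = \<phi>b 0\<close> the shock from \<open>0\<close> to \<open>\<phi>b 0\<close> is trivial.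
\<close>

definition riemann ::
  "(real \<Rightarrow> real) \<Rightarrow> (real \<Rightarrow> real) \<Rightarrow> real \<Rightarrow> real \<Rightarrow> wave list" where
  "riemann \<phi>b \<phi>s ul ur =
     filter (\<lambda>w. lstate w \<noteq> rstate w)
       (if 0 \<le> ul then riemann_nonneg \<phi>b \<phi>s ul ur
        else map mirror_wave (riemann_nonneg (mirror \<phi>b) (mirror \<phi>s) (- ul) (- ur)))"

definition strength :: "(real \<Rightarrow> real) \<Rightarrow> real \<Rightarrow> real \<Rightarrow> real" where
  "strength \<phi>0 a b =
     (if 0 \<le> a then (if 0 \<le> b then \<bar>a - b\<bar> else \<bar>a - \<phi>0 b\<bar>)
      else (if b < 0 then \<bar>\<phi>0 a - \<phi>0 b\<bar> else \<bar>\<phi>0 a - b\<bar>))"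

definition rarefaction_fronts ::
  "(real \<Rightarrow> real) \<Rightarrow> real \<Rightarrow> real \<Rightarrow> real \<Rightarrow> wave list \<Rightarrow> bool" where
  "rarefaction_fronts \<phi>0 \<epsilon> a b ws \<longleftrightarrow>
     (\<exists>vs. 2 \<le> length vs \<and> hd vs = a \<and> last vs = b \<and>
        (sorted_wrt (<) vs \<or> sorted_wrt (>) vs) \<and>
        ws = map2 (Wave Rarefaction) (butlast vs) (tl vs) \<and>
        (\<forall>w\<in>set ws. strength \<phi>0 (lstate w) (rstate w) < \<epsilon>))"

definition discretization ::
  "(real \<Rightarrow> real) \<Rightarrow> real \<Rightarrow> wave list \<Rightarrow> wave list \<Rightarrow> bool" where
  "discretization \<phi>0 \<epsilon> ws ws' \<longleftrightarrow>
     (\<exists>wss. ws' = concat wss \<and>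
        list_all2 (\<lambda>w xs. if kind w = Rarefaction
                           then rarefaction_fronts \<phi>0 \<epsilon> (lstate w) (rstate w) xs
                           else xs = [w]) ws wss)"


section \<open>Front-tracking approximations\<close>

text \<open>
  A front is a pair of a position and a wave. A list of fronts is ordered from left to right and
  may contain several fronts at one position, at a time when fronts meet or are created.
\<close>

type_synonym front = "real \<times> wave"

fun chained :: "real \<Rightarrow> wave list \<Rightarrow> bool" where
  "chained v [] \<longleftrightarrow> True"
| "chained v (w # ws) \<longleftrightarrow> lstate w = v \<and> chained (rstate w) ws"

text \<open>The right-continuous step function with value \<open>v\<close> at \<open>- \<infinity>\<close> and the given fronts as jumps.\<close>

definition step_fun :: "real \<Rightarrow> front list \<Rightarrow> real \<Rightarrow> real" where
  "step_fun v fs x = last (v # map (rstate \<circ> snd) (filter (\<lambda>p. fst p \<le> x) fs))"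

text \<open>Propagation for a (possibly negative) time \<open>\<tau>\<close> with the Rankine--Hugoniot speeds.\<close>

definition advance :: "(real \<Rightarrow> real) \<Rightarrow> real \<Rightarrow> front list \<Rightarrow> front list" where
  "advance f \<tau> fs = map (\<lambda>(y, w). (y + chord f (lstate w) (rstate w) * \<tau>, w)) fs"

definition waves_at :: "front list \<Rightarrow> real \<Rightarrow> wave list" where
  "waves_at fs y = map snd (filter (\<lambda>p. fst p = y) fs)"

text \<open>
  On one side of time \<open>t\<close>, given by the filter \<open>T\<close> (\<open>at_left t\<close> or \<open>at_right t\<close>), \<open>u\<close> consists of
  the fronts \<open>fs\<close>, the positions in \<open>fs\<close> being those at time \<open>t\<close> itself. Each front is an
  elementary wave of the solver: the Riemann problem with its two states is solved by it alone.
\<close>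

definition fronts_along ::
  "real filter \<Rightarrow> (real \<Rightarrow> real) \<Rightarrow> (real \<Rightarrow> real) \<Rightarrow> (real \<Rightarrow> real) \<Rightarrow>
   (real \<Rightarrow> real \<Rightarrow> real) \<Rightarrow> real \<Rightarrow> real \<Rightarrow> front list \<Rightarrow> bool" where
  "fronts_along T f \<phi>b \<phi>s u t v fs \<longleftrightarrow>
     chained v (map snd fs) \<and>
     (\<forall>(y, w)\<in>set fs. riemann \<phi>b \<phi>s (lstate w) (rstate w) = [w]) \<and>
     u t = step_fun v fs \<and>
     (\<forall>\<^sub>F s in T. sorted_wrt (<) (map fst (advance f (s - t) fs)) \<and>
                  u s = step_fun v (advance f (s - t) fs))"

text \<open>
  At most two fronts meet at a point. When two meet, the Riemann problem is solved, and an
  outgoing rarefaction is again a single discontinuity; a lone front continues unchanged.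
\<close>

fun interaction_rule ::
  "(real \<Rightarrow> real) \<Rightarrow> (real \<Rightarrow> real) \<Rightarrow> wave list \<Rightarrow> wave list \<Rightarrow> bool" where
  "interaction_rule \<phi>b \<phi>s [] outs \<longleftrightarrow> outs = []"
| "interaction_rule \<phi>b \<phi>s [w] outs \<longleftrightarrow> outs = [w]"
| "interaction_rule \<phi>b \<phi>s [w1, w2] outs \<longleftrightarrow> outs = riemann \<phi>b \<phi>s (lstate w1) (rstate w2)"
| "interaction_rule \<phi>b \<phi>s (w1 # w2 # w3 # ws) outs \<longleftrightarrow> False"

text \<open>\<open>fs\<close> and \<open>fs'\<close> are the fronts of \<open>u\<close> immediately before and immediately after time \<open>t\<close>.\<close>

definition evolves_at ::
  "(real \<Rightarrow> real) \<Rightarrow> (real \<Rightarrow> real) \<Rightarrow> (real \<Rightarrow> real) \<Rightarrow>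
   (real \<Rightarrow> real \<Rightarrow> real) \<Rightarrow> real \<Rightarrow> front list \<Rightarrow> front list \<Rightarrow> bool" where
  "evolves_at f \<phi>b \<phi>s u t fs fs' \<longleftrightarrow>
     (\<exists>v. fronts_along (at_left t) f \<phi>b \<phi>s u t v fs \<and>
          fronts_along (at_right t) f \<phi>b \<phi>s u t v fs') \<and>
     (\<forall>y. interaction_rule \<phi>b \<phi>s (waves_at fs y) (waves_at fs' y))"

definition bounded_variation :: "(real \<Rightarrow> real) \<Rightarrow> bool" where
  "bounded_variation g \<longleftrightarrow>
     (\<exists>B. \<forall>(n::nat) (x :: nat \<Rightarrow> real). mono x \<longrightarrow> (\<Sum>i<n. \<bar>g (x (Suc i)) - g (x i)\<bar>) \<le> B)"

text \<open>
  Here \<open>u t x\<close> is the value at time \<open>t\<close> and position \<open>x\<close>, and \<open>u 0\<close> is the piecewise constant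
  approximation of the initial data \<open>u0\<close>.
\<close>

definition front_tracking ::
  "(real \<Rightarrow> real) \<Rightarrow> (real \<Rightarrow> real) \<Rightarrow> (real \<Rightarrow> real) \<Rightarrow> (real \<Rightarrow> real) \<Rightarrow>
   real \<Rightarrow> (real \<Rightarrow> real) \<Rightarrow> (real \<Rightarrow> real \<Rightarrow> real) \<Rightarrow> bool" where
  "front_tracking f \<phi>0 \<phi>b \<phi>s \<epsilon> u0 u \<longleftrightarrow>
     integrable lborel (\<lambda>x. u 0 x - u0 x) \<and> (LINT x|lborel. \<bar>u 0 x - u0 x\<bar>) \<le> \<epsilon> \<and>
     (\<exists>v fs. fronts_along (at_right 0) f \<phi>b \<phi>s u 0 v fs \<and>
        (\<forall>y. waves_at fs y \<noteq> [] \<longrightarrow>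
           discretization \<phi>0 \<epsilon>
             (riemann \<phi>b \<phi>s (lstate (hd (waves_at fs y))) (rstate (last (waves_at fs y))))
             (waves_at fs y))) \<and>
     (\<forall>t>0. \<exists>fs fs'. evolves_at f \<phi>b \<phi>s u t fs fs')"


section \<open>The interaction functional\<close>

text \<open>The functional is defined for a piecewise constant function \<open>w\<close> of the space variable.\<close>

definition left_limit :: "(real \<Rightarrow> real) \<Rightarrow> real \<Rightarrow> real" where
  "left_limit w x = Lim (at_left x) w"

definition right_limit :: "(real \<Rightarrow> real) \<Rightarrow> real \<Rightarrow> real" where
  "right_limit w x = Lim (at_right x) w"

definition jumps :: "(real \<Rightarrow> real) \<Rightarrow> real set" where
  "jumps w = {x. left_limit w x \<noteq> right_limit w x}"

definition sigma :: "(real \<Rightarrow> real) \<Rightarrow> (real \<Rightarrow> real) \<Rightarrow> real \<Rightarrow> real" where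
  "sigma \<phi>0 w x =
     (if x \<in> jumps w then strength \<phi>0 (left_limit w x) (right_limit w x) else 0)"

definition hat :: "(real \<Rightarrow> real) \<Rightarrow> real \<Rightarrow> real" where
  "hat \<phi>0 u = (if 0 \<le> u then u else \<phi>0 u)"

definition normalized_speed ::
  "(real \<Rightarrow> real) \<Rightarrow> (real \<Rightarrow> real) \<Rightarrow> (real \<Rightarrow> real) \<Rightarrow> real \<Rightarrow> real" where
  "normalized_speed f \<phi>0 w x = chord f (hat \<phi>0 (left_limit w x)) (hat \<phi>0 (right_limit w x))"

definition same_monotonicity ::
  "(real \<Rightarrow> real) \<Rightarrow> (real \<Rightarrow> real) \<Rightarrow> real \<Rightarrow> real \<Rightarrow> bool" where
  "same_monotonicity \<phi>0 w x y \<longleftrightarrow>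
     (hat \<phi>0 (left_limit w x) < hat \<phi>0 (right_limit w x) \<and>
      hat \<phi>0 (left_limit w y) < hat \<phi>0 (right_limit w y)) \<or>
     (hat \<phi>0 (left_limit w x) > hat \<phi>0 (right_limit w x) \<and>
      hat \<phi>0 (left_limit w y) > hat \<phi>0 (right_limit w y))"

definition theta ::
  "(real \<Rightarrow> real) \<Rightarrow> (real \<Rightarrow> real) \<Rightarrow> real \<Rightarrow> (real \<Rightarrow> real) \<Rightarrow> real \<Rightarrow> real \<Rightarrow> real" where
  "theta f \<phi>0 C w x y =
     (if same_monotonicity \<phi>0 w x y
      then C * max (normalized_speed f \<phi>0 w x - normalized_speed f \<phi>0 w y) 0
      else 1)"

definition Q_pos ::
  "(real \<Rightarrow> real) \<Rightarrow> (real \<Rightarrow> real) \<Rightarrow> real \<Rightarrow> (real \<Rightarrow> real) \<Rightarrow> real" where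
  "Q_pos f \<phi>0 C w =
     (\<Sum>(x, y)\<in>{(x, y). x \<in> jumps w \<and> y \<in> jumps w \<and> x < y}.
        theta f \<phi>0 C w x y * sigma \<phi>0 w x * sigma \<phi>0 w y)"


section \<open>Exceptional interactions\<close>

text \<open>
  The cases RC-3, CR-4, CC-3, CN-3 and their mirror images, given by the kinds of the incoming and
  outgoing waves. The signs and the ordering of the states follow from these kinds because the
  waves come from the Riemann solver; for instance, if the left state is positive, the first
  pattern means \<open>0 < ul < um\<close>, \<open>\<phi>s um \<le> ur < um\<close> and \<open>\<phi>b ul < ur < \<phi>s ul\<close>. The borderline
  states, such as \<open>ur = \<phi>s um\<close>, for which the waves are of the same kinds, are thus included.
\<close>

definition exceptional :: "wave list \<Rightarrow> wave list \<Rightarrow> bool" where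
  "exceptional ins outs \<longleftrightarrow>
     (map kind ins, map kind outs) \<in>
       {([Rarefaction, Classical], [Nonclassical, Classical]),      \<comment> \<open>RC-3\<close>
        ([Classical, Rarefaction], [Nonclassical, Classical]),      \<comment> \<open>CR-4\<close>
        ([Classical, Classical], [Nonclassical, Classical]),        \<comment> \<open>CC-3\<close>
        ([Classical, Nonclassical], [Nonclassical, Classical])}     \<comment> \<open>CN-3\<close>"

text \<open>
  The mirror images (negative left state) of RC-2 and RN. For a positive state \<open>u\<close> the strength of
  the nonclassical shock leaving \<open>u\<close> is \<open>u - \<phi>0 (\<phi>b u)\<close>, for a negative one it is
  \<open>\<phi>0 u - \<phi>b u\<close>. As \<open>\<phi>0\<close> need not be affine, the lower Lipschitz bound for the former does not
  give one for the latter, and \<open>Q_pos\<close> may then increase in these two mirrored cases.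
\<close>

definition mirrored_RC2_or_RN :: "wave list \<Rightarrow> wave list \<Rightarrow> bool" where
  "mirrored_RC2_or_RN ins outs \<longleftrightarrow>
     (map kind ins, map kind outs) \<in>
       {([Rarefaction, Classical], [Nonclassical, Rarefaction]),
        ([Rarefaction, Nonclassical], [Nonclassical, Rarefaction])} \<and>
     lstate (hd ins) < 0"

end

theory Submission
  imports Defs
begin

text \<open>
  The functional is analysed in the normalized states \<open>hat \<phi>0 u \<ge> 0\<close>. There a rarefaction always
  increases and a shock, classical or not, always decreases (\<open>hat_kind\<close>), the generalized strength
  of a wave from \<open>p\<close> to \<open>q\<close> is \<open>\<bar>p - q\<bar>\<close>, and its speed is a chord slope of \<open>f\<close> on the half line
  where \<open>f\<close> is convex. Hence \<open>Q_pos\<close> is a sum over the pairs of a list of intervals, and an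
  interaction replaces two neighbours \<open>(l, m), (m, r)\<close> of this list by another path from \<open>l\<close> to \<open>r\<close>.

  The bound on \<open>C\<close> is independent of the total strength of the solution, so an increase against one
  wave cannot be paid for by a decrease against another one. The relation \<open>attenuates\<close> therefore asks for
  two things: that the new path has a smaller potential of its own, and that it puts no larger load
  on any other single wave, to its left or to its right. A wave of the opposite monotonicity counts
  with its full strength, one of the same monotonicity only with \<open>C\<close> times a speed difference. So
  for small \<open>C\<close> a change of speed is paid for by any strength that disappears from the waves of
  the other monotonicity. Three replacements have this property:

  \<^item> The two waves are joined to one, unless both increase (\<open>attenuates_single\<close>). If both decrease,
    the joint speed is the weighted mean of the two speeds, and the positive part is convex;
    otherwise the weaker wave is cancelled and its strength pays.
  \<^item> A minimum \<open>m\<close> is raised to \<open>k\<close> (\<open>attenuates_raise_bottom\<close>, case CR-3): both waves lose \<open>k - m\<close>.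
  \<^item> A rarefaction crosses a shock (\<open>attenuates_rarefaction_transmitted\<close>, cases RC-2 and RN). The
    speeds of the rarefaction before and after are unrelated, and the loss of strength must be at
    least a fixed proportion of the rarefaction. This is what the lower Lipschitz bound on
    \<open>u - \<phi>0 (\<phi>b u)\<close> provides, for a negative left state the one on \<open>\<phi>0 u - \<phi>b u\<close>.

  That every interaction other than RC-3, CR-4, CC-3 and CN-3 is of one of these forms follows from
  the Riemann solver and from the fact that fronts meet only if the left one is faster
  (\<open>collision_pos\<close>, \<open>collision_neg\<close>, \<open>collision_zero\<close>). The speeds exclude two rarefactions, and they
  exclude that a nonclassical shock catches up with another wave except to merge with it
  (\<open>nonclassical_slowest\<close>).

  The bound on \<open>C\<close> involves only the flux and the kinetic function on the states that can occur. These
  lie in \<open>{\<phi>0 R..R}\<close> at all times if they do initially (\<open>front_tracking_invariant\<close>), because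
  \<open>\<bar>\<phi>b u\<bar> < \<bar>\<phi>0 u\<bar>\<close> and \<open>\<phi>0\<close> is an involution.
\<close>

section \<open>The load of one wave on another\<close>

text \<open>
  The load of the wave \<open>(p, q)\<close> on a wave to its left, per unit strength of the latter,
  which has speed \<open>x\<close> and is increasing iff \<open>d\<close>. The load on a wave to its
  right has the same form with all speeds negated, as
  \<open>(s - x)\<^sup>+ = ((- x) - (- s))\<^sup>+\<close>.
\<close>

definition influence ::
  "(real \<Rightarrow> real \<Rightarrow> real) \<Rightarrow> real \<Rightarrow> bool \<Rightarrow> real \<Rightarrow> real \<Rightarrow> real \<Rightarrow> real" where
  "influence s C d x p q =
     (if (p < q) = d then C * max (x - s p q) 0 else 1) * \<bar>p - q\<bar>"

lemma max_shift:
  fixes x t t' m m' e R :: real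
  assumes "0 \<le> m'" "m' \<le> m" "m' \<le> R" "\<bar>t - t'\<bar> \<le> e"
  shows "max (x - t') 0 * m' \<le> max (x - t) 0 * m + e * R"
proof -
  have "max (x - t') 0 * m' \<le> (max (x - t) 0 + e) * m'"
    using assms by (intro mult_right_mono) auto
  also have "\<dots> = max (x - t) 0 * m' + e * m'" by (simp add: algebra_simps)
  also have "\<dots> \<le> max (x - t) 0 * m + e * R"
    using assms by (intro add_mono mult_left_mono) auto
  finally show ?thesis .
qed

text \<open>
  The slopes of the chords of a convex function have these properties, and so have the negated slopes:
  the axioms bound increments of the slopes without giving their sign. One set of inequalities thus
  serves for the loads on both sides.
\<close>

locale front_speed =
  fixes s :: "real \<Rightarrow> real \<Rightarrow> real" and R L C :: real
  assumes sym: "s p q = s q p"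
    and mix: "0 \<le> a \<Longrightarrow> a < b \<Longrightarrow> b < c \<Longrightarrow> c \<le> R \<Longrightarrow>
        s a c * (c - a) = s a b * (b - a) + s b c * (c - b)"
    and lip_upper: "0 \<le> a \<Longrightarrow> a < b \<Longrightarrow> b < c \<Longrightarrow> c \<le> R \<Longrightarrow> \<bar>s a c - s a b\<bar> \<le> L * (c - b)"
    and lip_lower: "0 \<le> a \<Longrightarrow> a < b \<Longrightarrow> b < c \<Longrightarrow> c \<le> R \<Longrightarrow> \<bar>s b c - s a c\<bar> \<le> L * (b - a)"
    and C_pos: "0 < C" and L_nonneg: "0 \<le> L" and C_small: "C * L * R \<le> 1"
begin

abbreviation infl where "infl \<equiv> influence s C"

lemma negated: "front_speed (\<lambda>p q. - s p q) R L C"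
proof unfold_locales
  fix a b c :: real assume "0 \<le> a" "a < b" "b < c" "c \<le> R"
  note abc = this
  show "- s a c * (c - a) = - s a b * (b - a) + - s b c * (c - b)"
    using mix[OF abc] by linarith
  show "\<bar>- s a c - - s a b\<bar> \<le> L * (c - b)" "\<bar>- s b c - - s a c\<bar> \<le> L * (b - a)"
    using lip_upper[OF abc] lip_lower[OF abc] by linarith+
qed (use sym C_pos L_nonneg C_small in auto)

lemma infl_nonneg: "0 \<le> infl d x p q"
  using C_pos by (auto simp: influence_def)

text \<open>
  Reversing both the wave and the direction of the observer halves the case distinctions below.
\<close>

lemma infl_reverse: "infl d x p q = infl (\<not> d) x q p"
  using sym[of p q] by (cases "p = q") (auto simp: influence_def abs_minus_commute)

text \<open>
  An end point that moves by \<open>e\<close> changes the speed by at most \<open>L * e\<close>. The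
  smallness of \<open>C\<close> keeps the cost of this below \<open>e\<close>, the strength that is cut
  off.
\<close>

lemma scaled_shift:
  assumes "0 \<le> m'" "m' \<le> m" "m' \<le> R" "\<bar>t - t'\<bar> \<le> L * e" "0 \<le> e"
  shows "C * max (x - t') 0 * m' \<le> C * max (x - t) 0 * m + e"
proof -
  have "C * (max (x - t') 0 * m') \<le> C * (max (x - t) 0 * m + L * e * R)"
    using max_shift[of m' m R t t' "L * e" x] assms C_pos by (intro mult_left_mono) auto
  also have "\<dots> = C * (max (x - t) 0 * m) + C * L * R * e" by (simp add: algebra_simps)
  also have "\<dots> \<le> C * (max (x - t) 0 * m) + 1 * e"
    using C_small assms by (intro add_left_mono mult_right_mono) auto
  finally show ?thesis by (simp add: algebra_simps)
qed

text \<open>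
  An increasing wave \<open>(b, c)\<close> is cancelled by a stronger decreasing one. An increasing
  observer sees less strength. A decreasing one sees a speed that has changed by at most
  \<open>L * (c - b)\<close>, but it has seen the cancelled wave with its full strength \<open>c - b\<close>.
\<close>

lemma fold_top:
  assumes "0 \<le> a" "a < b" "b < c" "c \<le> R"
  shows "infl d x b a \<le> infl d x b c + infl d x c a"
proof (cases d)
  case True
  then show ?thesis
    using assms infl_nonneg[of d x b c] by (simp add: influence_def)
next
  case False
  then show ?thesis
    using scaled_shift[of "b - a" "c - a" "s a c" "s a b" "c - b" x] lip_upper[OF assms] assms
      sym[of a b] sym[of a c] by (auto simp: influence_def)
qed

text \<open>
  The same balance at a minimum, where the decreasing wave \<open>(b, a)\<close> is the cancelled one.
\<close>

lemma fold_bottom: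
  assumes "0 \<le> a" "a < b" "b < c" "c \<le> R"
  shows "infl d x b c \<le> infl d x b a + infl d x a c"
proof (cases d)
  case False
  then show ?thesis
    using assms infl_nonneg[of d x b a] by (simp add: influence_def)
next
  case True
  then show ?thesis
    using scaled_shift[of "c - b" "c - a" "s a c" "s b c" "b - a" x] lip_lower[OF assms] assms
    by (auto simp: influence_def abs_minus_commute)
qed

text \<open>
  Jensen's inequality for the positive part: the joint speed is the mean of the two speeds, weighted by
  the strengths.
\<close>

lemma join_increasing:
  assumes "0 \<le> a" "a < b" "b < c" "c \<le> R"
  shows "infl d x a c \<le> infl d x a b + infl d x b c"
proof (cases d)
  case False
  then show ?thesis using assms by (auto simp: influence_def)
next
  case True
  have "(x - s a c) * (c - a) = (x - s a b) * (b - a) + (x - s b c) * (c - b)"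
    using mix[OF assms] by (simp add: algebra_simps)
  also have "\<dots> \<le> max (x - s a b) 0 * (b - a) + max (x - s b c) 0 * (c - b)"
    using assms by (intro add_mono mult_right_mono) auto
  finally have "max (x - s a c) 0 * (c - a) \<le> max (x - s a b) 0 * (b - a) + max (x - s b c) 0 * (c - b)"
    using assms by (auto simp: max_def)
  then have "C * (max (x - s a c) 0 * (c - a)) \<le>
      C * (max (x - s a b) 0 * (b - a) + max (x - s b c) 0 * (c - b))"
    using C_pos by (intro mult_left_mono) auto
  then show ?thesis using True assms by (auto simp: influence_def algebra_simps)
qed

lemma infl_merge:
  assumes "l \<in> {0..R}" "m \<in> {0..R}" "r \<in> {0..R}" "l \<noteq> m" "m \<noteq> r"
  shows "infl d x l r \<le> infl d x l m + infl d x m r"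
proof -
  note rev = infl_reverse[of d x]
  consider "l = r" | "l < m" "m < r" | "r < m" "m < l" | "r < l" "l < m" | "l < r" "r < m"
    | "m < l" "l < r" | "m < r" "r < l"
    using assms by linarith
  then show ?thesis
  proof cases
    case 1
    then show ?thesis using infl_nonneg[of d x l m] infl_nonneg[of d x m r]
      by (simp add: influence_def)
  next
    case 2
    then show ?thesis using join_increasing[of l m r] assms by auto
  next
    case 3
    then show ?thesis using join_increasing[of r m l "\<not> d" x] assms
      by (simp add: rev[of l r] rev[of l m] rev[of m r])
  next
    case 4
    then show ?thesis using fold_top[of r l m] assms by auto
  next
    case 5
    then show ?thesis using fold_top[of l r m "\<not> d" x] assms
      by (simp add: rev[of l r] rev[of l m] rev[of m r])
  next
    case 6
    then show ?thesis using fold_bottom[of m l r] assms by auto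
  next
    case 7
    then show ?thesis using fold_bottom[of m r l "\<not> d" x] assms
      by (simp add: rev[of l r] rev[of l m] rev[of m r])
  qed
qed

text \<open>
  Both waves lose the strength \<open>k - m\<close>. Every observer sees one of them with full weight,
  and this loss pays for the change of speed of the other one.
\<close>

lemma infl_raise_bottom:
  assumes "0 \<le> m" "m < k" "k < l" "k < r" "l \<le> R" "r \<le> R"
  shows "infl d x l k + infl d x k r \<le> infl d x l m + infl d x m r"
proof (cases d)
  case True
  have "C * max (x - s k r) 0 * (r - k) \<le> C * max (x - s m r) 0 * (r - m) + (k - m)"
    using lip_lower[of m k r] assms
    by (intro scaled_shift) (auto simp: abs_minus_commute)
  then show ?thesis using True assms by (simp add: influence_def)
next
  case False
  have "C * max (x - s k l) 0 * (l - k) \<le> C * max (x - s m l) 0 * (l - m) + (k - m)"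
    using lip_lower[of m k l] assms
    by (intro scaled_shift) (auto simp: abs_minus_commute)
  then show ?thesis using False assms sym[of k l] sym[of m l] by (simp add: influence_def)
qed

text \<open>
  The rarefaction \<open>(l, m)\<close> crosses the shock \<open>(m, r)\<close> and leaves as
  \<open>(k, r)\<close>. Both waves lose the strength \<open>(m - r) - (l - k)\<close>, which by
  \<open>gain\<close> is comparable to the strength of the rarefaction. For an observer that sees the
  shock with full weight this loss outweighs everything that the new rarefaction can contribute. For the
  other observers the speed of the shock changes by at most \<open>2 * L * (m - l)\<close>, and the same
  loss, now of the rarefaction, pays for it.
\<close>

lemma infl_rarefaction_transmitted:
  assumes "0 \<le> k" "k < l" "l < m" "m \<le> R" "k < r" "r < m"
    and gain: "c * (m - l) \<le> (m - r) - (l - k)"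
    and C_c: "2 * C * L * R \<le> c" and x: "\<bar>x - s k r\<bar> \<le> L * R"
  shows "infl d x l k + infl d x k r \<le> infl d x l m + infl d x m r"
proof -
  have cpos: "0 \<le> C * L * R" using C_pos L_nonneg assms by auto
  then have "0 \<le> c" using C_c by linarith
  then have "0 \<le> c * (m - l)" using assms by auto
  then have gain0: "0 \<le> (m - r) - (l - k)" using gain by linarith
  have Cg: "2 * C * L * R * (m - l) \<le> (m - r) - (l - k)"
    using mult_right_mono[OF C_c, of "m - l"] gain assms by linarith
  show ?thesis
  proof (cases d)
    case True
    have "C * max (x - s k r) 0 * (r - k) \<le> C * (L * R) * (m - l)"
      using x C_pos L_nonneg assms gain0 by (intro mult_mono) auto
    also have "\<dots> \<le> (m - r) - (l - k)" using Cg cpos assms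
      mult_nonneg_nonneg[OF cpos, of "m - l"] by (simp add: algebra_simps)
    finally show ?thesis using True assms C_pos by (simp add: influence_def sym[of l m] add_increasing)
  next
    case False
    have "\<bar>s k m - s k l\<bar> \<le> L * (m - l)" "\<bar>s r m - s k m\<bar> \<le> L * (r - k)"
      using lip_upper[of k l m] lip_lower[of k r m] assms by auto
    moreover have "L * (r - k) \<le> L * (m - l)" using L_nonneg gain0 by (intro mult_left_mono) auto
    ultimately have "\<bar>s r m - s k l\<bar> \<le> 2 * L * (m - l)" by linarith
    then have "max (x - s k l) 0 * (l - k) \<le> max (x - s r m) 0 * (m - r) + 2 * L * (m - l) * R"
      using assms gain0 by (intro max_shift) auto
    then have "C * (max (x - s k l) 0 * (l - k)) \<le>
        C * (max (x - s r m) 0 * (m - r) + 2 * L * (m - l) * R)"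
      using C_pos by (intro mult_left_mono) auto
    also have "\<dots> \<le> C * (max (x - s r m) 0 * (m - r)) + ((m - r) - (l - k))"
      using Cg by (simp add: algebra_simps)
    finally show ?thesis using False assms sym[of k l] sym[of m r] by (simp add: influence_def)
  qed
qed

end

section \<open>Chord slopes of a convex flux\<close>

lemma chord_commute: "chord f u v = chord f v u"
  unfolding chord_def by (metis minus_diff_eq minus_divide_divide)

lemma chord_split:
  assumes "a < b" "b < c"
  shows "chord f a c * (c - a) = chord f a b * (b - a) + chord f b c * (c - b)"
  using assms by (simp add: chord_def)

lemma chord_mean_value:
  assumes "\<And>x. (f has_real_derivative deriv f x) (at x)" "a < b"
  obtains \<xi> where "a < \<xi>" "\<xi> < b" "chord f a b = deriv f \<xi>"
proof -
  obtain \<xi> where "a < \<xi>" "\<xi> < b" "f b - f a = (b - a) * deriv f \<xi>"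
    using MVT2[of a b f "deriv f"] assms by blast
  then show ?thesis using assms(2) that[of \<xi>] by (simp add: chord_def)
qed

locale convex_flux =
  fixes f :: "real \<Rightarrow> real" and R L :: real
  assumes has_deriv: "(f has_real_derivative deriv f x) (at x)"
    and deriv_less: "0 \<le> x \<Longrightarrow> x < y \<Longrightarrow> y \<le> R \<Longrightarrow> deriv f x < deriv f y"
    and deriv_lip: "0 \<le> x \<Longrightarrow> x < y \<Longrightarrow> y \<le> R \<Longrightarrow> deriv f y - deriv f x \<le> L * (y - x)"
    and L_nonneg: "0 \<le> L"
begin

lemma chord_gap:
  assumes "0 \<le> a" "a < b" "b < c" "c \<le> R"
  shows "chord f a b < chord f b c" "chord f b c - chord f a b \<le> L * (c - a)"
proof -
  obtain \<xi> where x: "a < \<xi>" "\<xi> < b" "chord f a b = deriv f \<xi>"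
    using chord_mean_value[OF has_deriv assms(2)] by blast
  obtain \<eta> where y: "b < \<eta>" "\<eta> < c" "chord f b c = deriv f \<eta>"
    using chord_mean_value[OF has_deriv assms(3)] by blast
  show "chord f a b < chord f b c" using deriv_less[of \<xi> \<eta>] x y assms by simp
  have "deriv f \<eta> - deriv f \<xi> \<le> L * (\<eta> - \<xi>)" using deriv_lip[of \<xi> \<eta>] x y assms by simp
  also have "\<dots> \<le> L * (c - a)" using x y L_nonneg by (intro mult_left_mono) auto
  finally show "chord f b c - chord f a b \<le> L * (c - a)" using x y by simp
qed

lemma chord_upper:
  assumes "0 \<le> a" "a < b" "b < c" "c \<le> R"
  shows "chord f a b < chord f a c" "chord f a c - chord f a b \<le> L * (c - b)"
proof -
  have *: "(chord f a c - chord f a b) * (c - a) = (chord f b c - chord f a b) * (c - b)"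
    using chord_split[OF assms(2,3), of f] by (simp add: algebra_simps)
  moreover have "0 < (chord f b c - chord f a b) * (c - b)" using chord_gap[OF assms] assms by auto
  ultimately have "0 < (chord f a c - chord f a b) * (c - a)" by simp
  then show "chord f a b < chord f a c" using assms by (simp add: zero_less_mult_iff)
  have "(chord f b c - chord f a b) * (c - b) \<le> L * (c - a) * (c - b)"
    using chord_gap[OF assms] assms by (intro mult_right_mono) auto
  then have "(chord f a c - chord f a b) * (c - a) \<le> L * (c - b) * (c - a)"
    using * by (simp add: algebra_simps)
  then show "chord f a c - chord f a b \<le> L * (c - b)" using assms by simp
qed

lemma chord_lower:
  assumes "0 \<le> a" "a < b" "b < c" "c \<le> R"
  shows "chord f a c < chord f b c" "chord f b c - chord f a c \<le> L * (b - a)"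
proof -
  have *: "(chord f b c - chord f a c) * (c - a) = (chord f b c - chord f a b) * (b - a)"
    using chord_split[OF assms(2,3), of f] by (simp add: algebra_simps)
  moreover have "0 < (chord f b c - chord f a b) * (b - a)" using chord_gap[OF assms] assms by auto
  ultimately have "0 < (chord f b c - chord f a c) * (c - a)" by simp
  then show "chord f a c < chord f b c" using assms by (simp add: zero_less_mult_iff)
  have "(chord f b c - chord f a b) * (b - a) \<le> L * (c - a) * (b - a)"
    using chord_gap[OF assms] assms by (intro mult_right_mono) auto
  then have "(chord f b c - chord f a c) * (c - a) \<le> L * (b - a) * (c - a)"
    using * by (simp add: algebra_simps)
  then show "chord f b c - chord f a c \<le> L * (b - a)" using assms by simp
qed

lemma chord_oscillation:
  assumes "p \<in> {0..R}" "q \<in> {0..R}" "p \<noteq> q" "p' \<in> {0..R}" "q' \<in> {0..R}" "p' \<noteq> q'"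
  shows "\<bar>chord f p q - chord f p' q'\<bar> \<le> L * R"
proof -
  have slope: "\<exists>\<xi>\<in>{0..R}. chord f a b = deriv f \<xi>" if "a \<in> {0..R}" "b \<in> {0..R}" "a \<noteq> b" for a b
  proof -
    have "\<exists>\<xi>\<in>{0..R}. chord f a b = deriv f \<xi>" if "a \<in> {0..R}" "b \<in> {0..R}" "a < b" for a b
      using chord_mean_value[OF has_deriv \<open>a < b\<close>] that by (metis atLeastAtMost_iff less_imp_le order_trans)
    then show ?thesis using that chord_commute[of f a b] by (metis linorder_neqE_linordered_idom)
  qed
  have osc: "\<bar>deriv f x - deriv f y\<bar> \<le> L * R" if "x \<in> {0..R}" "y \<in> {0..R}" for x y
  proof -
    have le: "\<bar>deriv f y - deriv f x\<bar> \<le> L * R" if "x \<in> {0..R}" "y \<in> {0..R}" "x < y" for x y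
    proof -
      have "L * (y - x) \<le> L * R" using that L_nonneg by (intro mult_left_mono) auto
      then show ?thesis using deriv_less[of x y] deriv_lip[of x y] that by auto
    qed
    have "0 \<le> L * R" using that L_nonneg by auto
    then show ?thesis using le[of x y] le[of y x] that
      by (cases x y rule: linorder_cases) (auto simp: abs_minus_commute)
  qed
  show ?thesis using slope[of p q] slope[of p' q'] osc assms by metis
qed

lemma front_speed_chord:
  assumes "0 < C" "C * L * R \<le> 1"
  shows "front_speed (chord f) R L C"
proof unfold_locales
  fix a b c :: real assume abc: "0 \<le> a" "a < b" "b < c" "c \<le> R"
  show "chord f a c * (c - a) = chord f a b * (b - a) + chord f b c * (c - b)"
    using chord_split abc by blast
  show "\<bar>chord f a c - chord f a b\<bar> \<le> L * (c - b)" using chord_upper[OF abc] by simp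
  show "\<bar>chord f b c - chord f a c\<bar> \<le> L * (b - a)" using chord_lower[OF abc] by simp
qed (use assms L_nonneg chord_commute in auto)

end

section \<open>Pairwise potentials of lists of waves\<close>

fun potential :: "('a \<Rightarrow> 'a \<Rightarrow> real) \<Rightarrow> 'a list \<Rightarrow> real" where
  "potential g [] = 0"
| "potential g (w # ws) = (\<Sum>z\<leftarrow>ws. g w z) + potential g ws"

lemma potential_append:
  "potential g (xs @ ys) = potential g xs + (\<Sum>x\<leftarrow>xs. \<Sum>y\<leftarrow>ys. g x y) + potential g ys"
  by (induction xs) auto

lemma sum_list_swap:
  fixes g :: "'a \<Rightarrow> 'b \<Rightarrow> real"
  shows "(\<Sum>x\<leftarrow>xs. \<Sum>y\<leftarrow>ys. g x y) = (\<Sum>y\<leftarrow>ys. \<Sum>x\<leftarrow>xs. g x y)"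
  by (induction xs) (auto simp: sum_list_addf)

text \<open>
  The list \<open>ins\<close> may be replaced by \<open>outs\<close> between any neighbours taken from
  \<open>Z\<close>. The loads are compared for each \<open>z\<close> alone, because the neighbours can
  be arbitrarily many.
\<close>

definition attenuates :: "('a \<Rightarrow> 'a \<Rightarrow> real) \<Rightarrow> 'a set \<Rightarrow> 'a list \<Rightarrow> 'a list \<Rightarrow> bool" where
  "attenuates g Z ins outs \<longleftrightarrow> potential g outs < potential g ins \<and>
     (\<forall>z\<in>Z. (\<Sum>w\<leftarrow>outs. g z w) \<le> (\<Sum>w\<leftarrow>ins. g z w) \<and> (\<Sum>w\<leftarrow>outs. g w z) \<le> (\<Sum>w\<leftarrow>ins. g w z))"

lemma attenuates_in_context:
  assumes "attenuates g Z ins outs" "set pre \<subseteq> Z" "set post \<subseteq> Z"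
  shows "potential g (pre @ outs @ post) < potential g (pre @ ins @ post)"
proof -
  have "(\<Sum>x\<leftarrow>pre. \<Sum>y\<leftarrow>outs. g x y) \<le> (\<Sum>x\<leftarrow>pre. \<Sum>y\<leftarrow>ins. g x y)"
    using assms by (intro sum_list_mono) (auto simp: attenuates_def)
  moreover have "(\<Sum>x\<leftarrow>outs. \<Sum>y\<leftarrow>post. g x y) \<le> (\<Sum>x\<leftarrow>ins. \<Sum>y\<leftarrow>post. g x y)"
    using assms unfolding sum_list_swap[where g = g and ys = post]
    by (intro sum_list_mono) (auto simp: attenuates_def)
  ultimately show ?thesis
    using assms by (simp add: potential_append sum_list_addf attenuates_def)
qed

text \<open>
  A summand \<open>\<theta> \<sigma> \<sigma>\<close> of the functional, as a function of the normalized
  states of the two waves.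
\<close>

definition pair_weight ::
  "(real \<Rightarrow> real \<Rightarrow> real) \<Rightarrow> real \<Rightarrow> real \<times> real \<Rightarrow> real \<times> real \<Rightarrow> real" where
  "pair_weight s C z w =
     (if fst z < snd z \<and> fst w < snd w \<or> fst z > snd z \<and> fst w > snd w
      then C * max (s (fst z) (snd z) - s (fst w) (snd w)) 0 else 1)
     * \<bar>fst z - snd z\<bar> * \<bar>fst w - snd w\<bar>"

lemma pair_weight_left:
  assumes "p \<noteq> q"
  shows "pair_weight s C (p, q) (a, b) = \<bar>p - q\<bar> * influence s C (p < q) (s p q) a b"
  using assms by (cases "a = b") (auto simp: pair_weight_def influence_def)

lemma pair_weight_right:
  assumes "p \<noteq> q"
  shows "pair_weight s C (a, b) (p, q) =
    \<bar>p - q\<bar> * influence (\<lambda>p q. - s p q) C (p < q) (- s p q) a b"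
  using assms by (cases "a = b") (auto simp: pair_weight_def influence_def)

definition pairs_upto :: "real \<Rightarrow> (real \<times> real) set" where
  "pairs_upto R = {(p, q). p \<in> {0..R} \<and> q \<in> {0..R} \<and> p \<noteq> q}"

lemma attenuatesI:
  assumes pot: "potential (pair_weight s C) outs < potential (pair_weight s C) ins"
    and left: "\<And>p q d. (p, q) \<in> pairs_upto R \<Longrightarrow>
      (\<Sum>(a, b)\<leftarrow>outs. influence s C d (s p q) a b) \<le> (\<Sum>(a, b)\<leftarrow>ins. influence s C d (s p q) a b)"
    and right: "\<And>p q d. (p, q) \<in> pairs_upto R \<Longrightarrow>
      (\<Sum>(a, b)\<leftarrow>outs. influence (\<lambda>p q. - s p q) C d (- s p q) a b) \<le>
      (\<Sum>(a, b)\<leftarrow>ins. influence (\<lambda>p q. - s p q) C d (- s p q) a b)"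
  shows "attenuates (pair_weight s C) (pairs_upto R) ins outs"
proof -
  have l: "(\<Sum>w\<leftarrow>ws. pair_weight s C (p, q) w) =
      \<bar>p - q\<bar> * (\<Sum>(a, b)\<leftarrow>ws. influence s C (p < q) (s p q) a b)" if "p \<noteq> q" for ws p q
    by (induction ws) (auto simp: pair_weight_left[OF that] distrib_left)
  have r: "(\<Sum>w\<leftarrow>ws. pair_weight s C w (p, q)) =
      \<bar>p - q\<bar> * (\<Sum>(a, b)\<leftarrow>ws. influence (\<lambda>p q. - s p q) C (p < q) (- s p q) a b)"
    if "p \<noteq> q" for ws p q
    by (induction ws) (auto simp: pair_weight_right[OF that] distrib_left)
  show ?thesis unfolding attenuates_def
  proof (intro conjI ballI)
    show "potential (pair_weight s C) outs < potential (pair_weight s C) ins" by (fact pot)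
    fix z assume z: "z \<in> pairs_upto R"
    then obtain p q where pq: "z = (p, q)" "p \<noteq> q" by (auto simp: pairs_upto_def)
    show "(\<Sum>w\<leftarrow>outs. pair_weight s C z w) \<le> (\<Sum>w\<leftarrow>ins. pair_weight s C z w)"
      unfolding pq l[OF pq(2)] using left z pq by (intro mult_left_mono) auto
    show "(\<Sum>w\<leftarrow>outs. pair_weight s C w z) \<le> (\<Sum>w\<leftarrow>ins. pair_weight s C w z)"
      unfolding pq r[OF pq(2)] using right z pq by (intro mult_left_mono) auto
  qed
qed

context convex_flux begin

lemma attenuates_single:
  assumes C: "0 < C" "C * L * R \<le> 1"
    and states: "l \<in> {0..R}" "m \<in> {0..R}" "r \<in> {0..R}" "l \<noteq> m" "m \<noteq> r" "\<not> (l < m \<and> m < r)"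
    and outs: "outs = (if l = r then [] else [(l, r)])"
  shows "attenuates (pair_weight (chord f) C) (pairs_upto R) [(l, m), (m, r)] outs"
proof (rule attenuatesI)
  interpret s: front_speed "chord f" R L C by (rule front_speed_chord[OF C])
  interpret n: front_speed "\<lambda>p q. - chord f p q" R L C by (rule s.negated)
  show "potential (pair_weight (chord f) C) outs < potential (pair_weight (chord f) C) [(l, m), (m, r)]"
    using states outs C chord_gap(1)[of r m l] chord_commute[of f l m] chord_commute[of f m r]
    by (auto simp: pair_weight_def)
  show "(\<Sum>(a, b)\<leftarrow>outs. influence (chord f) C d x a b) \<le>
      (\<Sum>(a, b)\<leftarrow>[(l, m), (m, r)]. influence (chord f) C d x a b)" for d x
    using s.infl_merge[of l m r d x] states by (auto simp: outs influence_def)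
  show "(\<Sum>(a, b)\<leftarrow>outs. influence (\<lambda>p q. - chord f p q) C d x a b) \<le>
      (\<Sum>(a, b)\<leftarrow>[(l, m), (m, r)]. influence (\<lambda>p q. - chord f p q) C d x a b)" for d x
    using n.infl_merge[of l m r d x] states by (auto simp: outs influence_def)
qed

lemma attenuates_raise_bottom:
  assumes C: "0 < C" "C * L * R \<le> 1"
    and states: "0 \<le> m" "m < k" "k < l" "k < r" "l \<le> R" "r \<le> R"
  shows "attenuates (pair_weight (chord f) C) (pairs_upto R) [(l, m), (m, r)] [(l, k), (k, r)]"
proof (rule attenuatesI)
  interpret s: front_speed "chord f" R L C by (rule front_speed_chord[OF C])
  interpret n: front_speed "\<lambda>p q. - chord f p q" R L C by (rule s.negated)
  have "(l - k) * (r - k) < (l - m) * (r - m)" using states by (intro mult_strict_mono) auto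
  then show "potential (pair_weight (chord f) C) [(l, k), (k, r)] <
      potential (pair_weight (chord f) C) [(l, m), (m, r)]"
    using states by (simp add: pair_weight_def)
  show "(\<Sum>(a, b)\<leftarrow>[(l, k), (k, r)]. influence (chord f) C d x a b) \<le>
      (\<Sum>(a, b)\<leftarrow>[(l, m), (m, r)]. influence (chord f) C d x a b)"
    "(\<Sum>(a, b)\<leftarrow>[(l, k), (k, r)]. influence (\<lambda>p q. - chord f p q) C d x a b) \<le>
      (\<Sum>(a, b)\<leftarrow>[(l, m), (m, r)]. influence (\<lambda>p q. - chord f p q) C d x a b)" for d x
    using s.infl_raise_bottom[OF states] n.infl_raise_bottom[OF states] by auto
qed

lemma attenuates_rarefaction_transmitted:
  assumes C: "0 < C" "C * L * R \<le> 1" "2 * C * L * R \<le> c" "0 < c"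
    and states: "0 \<le> k" "k < l" "l < m" "m \<le> R" "k < r" "r < m"
    and gain: "c * (m - l) \<le> (m - r) - (l - k)"
  shows "attenuates (pair_weight (chord f) C) (pairs_upto R) [(l, m), (m, r)] [(l, k), (k, r)]"
proof (rule attenuatesI)
  interpret s: front_speed "chord f" R L C by (rule front_speed_chord[OF C(1,2)])
  interpret n: front_speed "\<lambda>p q. - chord f p q" R L C by (rule s.negated)
  have "0 < c * (m - l)" using C states by simp
  then have "(r - k) * (l - k) < (m - l) * (m - r)"
    using states gain by (intro mult_strict_mono) auto
  then show "potential (pair_weight (chord f) C) [(l, k), (k, r)] <
      potential (pair_weight (chord f) C) [(l, m), (m, r)]"
    using states by (simp add: pair_weight_def mult.commute)
  fix p q d assume "(p, q) \<in> pairs_upto R"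
  then have "\<bar>chord f p q - chord f k r\<bar> \<le> L * R"
    using states by (intro chord_oscillation) (auto simp: pairs_upto_def)
  then show "(\<Sum>(a, b)\<leftarrow>[(l, k), (k, r)]. influence (chord f) C d (chord f p q) a b) \<le>
      (\<Sum>(a, b)\<leftarrow>[(l, m), (m, r)]. influence (chord f) C d (chord f p q) a b)"
    "(\<Sum>(a, b)\<leftarrow>[(l, k), (k, r)]. influence (\<lambda>p q. - chord f p q) C d (- chord f p q) a b) \<le>
      (\<Sum>(a, b)\<leftarrow>[(l, m), (m, r)]. influence (\<lambda>p q. - chord f p q) C d (- chord f p q) a b)"
    using s.infl_rarefaction_transmitted[OF states gain C(3)]
      n.infl_rarefaction_transmitted[OF states gain C(3)] by (auto simp: abs_minus_commute)
qed

end

section \<open>The nonclassical Riemann solver and binary collisions\<close>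

lemma chord_less_chord:
  assumes d: "\<And>x. (f has_real_derivative deriv f x) (at x)"
    and inc: "\<And>x y. a \<le> x \<Longrightarrow> x < y \<Longrightarrow> y \<le> c \<Longrightarrow> deriv f x < deriv f y"
    and "a < b" "b < c"
  shows "chord f a b < chord f b c"
proof -
  obtain \<xi> where x: "a < \<xi>" "\<xi> < b" "chord f a b = deriv f \<xi>"
    using chord_mean_value[OF d \<open>a < b\<close>] by blast
  obtain \<eta> where y: "b < \<eta>" "\<eta> < c" "chord f b c = deriv f \<eta>"
    using chord_mean_value[OF d \<open>b < c\<close>] by blast
  show ?thesis using inc[of \<xi> \<eta>] x y by simp
qed

text \<open>
  Turns an inequality between the slopes of adjacent chords into one between three values of
  \<open>g\<close>.
\<close>

lemma chord_gap_three_points: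
  assumes "a < b" "b < c"
  shows "(chord g b c - chord g a b) * ((b - a) * (c - b)) =
    (c - b) * g a + (b - a) * g c - (c - a) * g b"
proof -
  have "chord g b c * (c - b) = g c - g b" "chord g a b * (b - a) = g b - g a"
    using assms by (auto simp: chord_def)
  then show ?thesis by algebra
qed

locale kinetic_solver =
  fixes f \<phi>b \<phi>s :: "real \<Rightarrow> real"
  assumes f_deriv: "(f has_real_derivative deriv f x) (at x)"
    and convex_right: "0 \<le> x \<Longrightarrow> x < y \<Longrightarrow> deriv f x < deriv f y"
    and concave_left: "x < y \<Longrightarrow> y \<le> 0 \<Longrightarrow> deriv f y < deriv f x"
    and \<phi>b_less: "x < y \<Longrightarrow> \<phi>b y < \<phi>b x"
    and \<phi>b_0: "\<phi>b 0 = 0"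
    and \<phi>s_pos: "0 < u \<Longrightarrow> \<phi>b u < \<phi>s u \<and> \<phi>s u < u"
    and \<phi>s_neg: "u < 0 \<Longrightarrow> u < \<phi>s u \<and> \<phi>s u < \<phi>b u"
    and \<phi>s_chord: "u \<noteq> 0 \<Longrightarrow> chord f u (\<phi>s u) = chord f u (\<phi>b u)"
begin

lemma \<phi>b_neg: "0 < u \<Longrightarrow> \<phi>b u < 0"
  using \<phi>b_less[of 0 u] \<phi>b_0 by simp

lemma \<phi>b_pos: "u < 0 \<Longrightarrow> 0 < \<phi>b u"
  using \<phi>b_less[of u 0] \<phi>b_0 by simp

lemma deriv_mirror: "(mirror f has_real_derivative deriv f (- x)) (at x)"
proof -
  have "((\<lambda>u. - f (- u)) has_real_derivative - (deriv f (- x) * (- 1))) (at x)"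
    by (rule DERIV_minus DERIV_chain2 f_deriv derivative_eq_intros refl)+
  then show ?thesis by (simp add: mirror_def[abs_def])
qed

lemma chord_mirror: "chord (mirror f) u v = chord f (- u) (- v)"
  unfolding chord_def mirror_def by (metis minus_diff_eq minus_diff_minus minus_divide_divide)

text \<open>
  The reflection \<open>u \<mapsto> - u\<close> exchanges the two signs of the left state. It is not
  compatible with the normalized states, so it serves for statements about the solver only.
\<close>

lemma mirrored: "kinetic_solver (mirror f) (mirror \<phi>b) (mirror \<phi>s)"
proof unfold_locales
  have d: "deriv (mirror f) x = deriv f (- x)" for x
    by (rule DERIV_imp_deriv[OF deriv_mirror])
  show "(mirror f has_real_derivative deriv (mirror f) x) (at x)" for x
    unfolding d by (rule deriv_mirror)
  show "deriv (mirror f) x < deriv (mirror f) y" if "0 \<le> x" "x < y" for x y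
    unfolding d using concave_left that by simp
  show "deriv (mirror f) y < deriv (mirror f) x" if "x < y" "y \<le> 0" for x y
    unfolding d using convex_right that by simp
  show "chord (mirror f) u (mirror \<phi>s u) = chord (mirror f) u (mirror \<phi>b u)" if "u \<noteq> 0" for u
    unfolding chord_mirror using \<phi>s_chord[of "- u"] that by (simp add: mirror_def)
  show "mirror \<phi>b u < mirror \<phi>s u \<and> mirror \<phi>s u < u" if "0 < u" for u
    using \<phi>s_neg[of "- u"] that by (simp add: mirror_def)
  show "u < mirror \<phi>s u \<and> mirror \<phi>s u < mirror \<phi>b u" if "u < 0" for u
    using \<phi>s_pos[of "- u"] that by (simp add: mirror_def)
qed (use \<phi>b_less \<phi>b_0 in \<open>auto simp: mirror_def\<close>)

lemma riemann_pos:
  assumes "0 < a"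
  shows "riemann \<phi>b \<phi>s a b =
    (if a = b then [] else if a < b then [Wave Rarefaction a b]
     else if b < \<phi>b a then [Wave Nonclassical a (\<phi>b a), Wave Rarefaction (\<phi>b a) b]
     else if b = \<phi>b a then [Wave Nonclassical a b]
     else if b < \<phi>s a then [Wave Nonclassical a (\<phi>b a), Wave Classical (\<phi>b a) b]
     else [Wave Classical a b])"
  using assms \<phi>b_neg[OF assms] by (auto simp: riemann_def riemann_nonneg_def)

lemma riemann_zero: "riemann \<phi>b \<phi>s 0 b = (if b = 0 then [] else [Wave Rarefaction 0 b])"
  by (auto simp: riemann_def riemann_nonneg_def \<phi>b_0)

lemma riemann_neg:
  assumes "a < 0"
  shows "riemann \<phi>b \<phi>s a b =
    (if a = b then [] else if b < a then [Wave Rarefaction a b]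
     else if \<phi>b a < b then [Wave Nonclassical a (\<phi>b a), Wave Rarefaction (\<phi>b a) b]
     else if b = \<phi>b a then [Wave Nonclassical a b]
     else if \<phi>s a < b then [Wave Nonclassical a (\<phi>b a), Wave Classical (\<phi>b a) b]
     else [Wave Classical a b])"
  using assms \<phi>b_pos[OF assms] by (auto simp: riemann_def riemann_nonneg_def mirror_def)

lemma riemann_mirror:
  "riemann (mirror \<phi>b) (mirror \<phi>s) (- a) (- b) = map mirror_wave (riemann \<phi>b \<phi>s a b)"
proof -
  interpret m: kinetic_solver "mirror f" "mirror \<phi>b" "mirror \<phi>s" by (rule mirrored)
  show ?thesis
    using riemann_pos[of a b] riemann_neg[of a b] riemann_zero[of b]
      m.riemann_pos[of "- a" "- b"] m.riemann_neg[of "- a" "- b"] m.riemann_zero[of "- b"]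
    by (cases a "0 :: real" rule: linorder_cases) (simp_all add: mirror_def)
qed

lemma single_pos:
  assumes "0 < a" "riemann \<phi>b \<phi>s a b = [w]"
  shows "kind w = Rarefaction \<and> a < b \<or> kind w = Nonclassical \<and> b = \<phi>b a \<or>
    kind w = Classical \<and> \<phi>s a \<le> b \<and> b < a"
  using assms riemann_pos[OF assms(1), of b] by (auto split: if_splits)

lemma single_neg:
  assumes "a < 0" "riemann \<phi>b \<phi>s a b = [w]"
  shows "kind w = Rarefaction \<and> b < a \<or> kind w = Nonclassical \<and> b = \<phi>b a \<or>
    kind w = Classical \<and> b \<le> \<phi>s a \<and> a < b"
  using assms riemann_neg[OF assms(1), of b] by (auto split: if_splits)

lemma riemann_single_states:
  assumes "riemann \<phi>b \<phi>s a b = [w]"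
  shows "lstate w = a" "rstate w = b" "a \<noteq> b"
  using assms riemann_pos[of a b] riemann_neg[of a b] riemann_zero[of b]
  by (cases a "0 :: real" rule: linorder_cases; auto split: if_splits)+

text \<open>
  Every wave from \<open>\<phi>b u\<close> to a state below \<open>\<phi>s u\<close> is faster than the
  nonclassical shock arriving at \<open>\<phi>b u\<close>, which hence never catches up with it. Let
  \<open>g\<close> be \<open>f\<close> minus the affine function that agrees with \<open>f\<close> at
  \<open>v = \<phi>b u\<close> and at \<open>u\<close>. Then \<open>g\<close> vanishes at
  \<open>v\<close>, at \<open>w = \<phi>s u\<close> and at \<open>u\<close>. As \<open>g\<close> is
  strictly concave on the left and strictly convex on the right of \<open>0\<close>, it is negative on
  the left of \<open>v\<close> and positive between \<open>v\<close> and \<open>w\<close>.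
\<close>

lemma nonclassical_slowest:
  assumes u: "0 < u" and x: "x < \<phi>s u" "x \<noteq> \<phi>b u"
  shows "chord f u (\<phi>b u) < chord f (\<phi>b u) x"
proof -
  define v w s where "v = \<phi>b u" and "w = \<phi>s u" and "s = chord f u v"
  define g where "g y = f y - f v - s * (y - v)" for y
  have order: "v < w" "w < u" "v < 0" using \<phi>s_pos \<phi>b_neg u by (auto simp: v_def w_def)
  have "s * (v - u) = f v - f u" using order by (simp add: s_def chord_def)
  moreover have "s = chord f u w" using \<phi>s_chord[of u] u by (simp add: s_def v_def w_def)
  then have "s * (w - u) = f w - f u" using order by (simp add: chord_def)
  ultimately have zeros: "g v = 0" "g w = 0" "g u = 0" by (auto simp: g_def algebra_simps)
  have chord_g: "chord g a b = chord f a b - s" if "a \<noteq> b" for a b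
    using that by (simp add: chord_def g_def field_simps)
  have convex: "(c - a) * g b < (c - b) * g a + (b - a) * g c" if "0 \<le> a" "a < b" "b < c" for a b c
  proof -
    have "chord f a b < chord f b c"
      by (rule chord_less_chord[OF f_deriv]) (use convex_right that in auto)
    then have "0 < (chord g b c - chord g a b) * ((b - a) * (c - b))" using chord_g that by simp
    then show ?thesis using chord_gap_three_points[of a b c g] that by simp
  qed
  have concave: "(c - b) * g a + (b - a) * g c < (c - a) * g b" if "c \<le> 0" "a < b" "b < c" for a b c
  proof -
    have "- chord f a b < - chord f b c"
    proof -
      have d: "((\<lambda>y. - f y) has_real_derivative - deriv f y) (at y)" for y
        by (rule DERIV_minus[OF f_deriv])
      have "chord (\<lambda>y. - f y) a b < chord (\<lambda>y. - f y) b c"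
        by (rule chord_less_chord)
          (use d DERIV_imp_deriv[OF d] concave_left that in auto)
      moreover have "chord (\<lambda>y. - f y) a b = - chord f a b" for a b
        by (simp add: chord_def minus_divide_left)
      ultimately show ?thesis by simp
    qed
    then have "0 < (chord g a b - chord g b c) * ((b - a) * (c - b))" using chord_g that by simp
    then show ?thesis using chord_gap_three_points[of a b c g] that by (simp add: algebra_simps)
  qed
  have g0: "0 < g 0" if "0 < w"
    using convex[of 0 w u] zeros order that by (simp add: zero_less_mult_iff)
  have "0 < g x / (x - v)"
  proof (cases "x < v")
    case True
    have "g x < 0"
    proof (cases "0 < w")
      case True
      have "- v * g x + (v - x) * g 0 < 0" using concave[of 0 x v] zeros order \<open>x < v\<close> by simp
      moreover have "0 < (v - x) * g 0" using g0 True \<open>x < v\<close> by simp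
      ultimately have "- v * g x < 0" by linarith
      then show ?thesis using order by (simp add: zero_less_mult_iff)
    next
      case False
      have "(w - v) * g x < 0" using concave[of w x v] zeros order \<open>x < v\<close> False by simp
      then show ?thesis using order by (simp add: mult_less_0_iff)
    qed
    then show ?thesis using True by (simp add: zero_less_divide_iff)
  next
    case False
    then have vx: "v < x" "x < w" using x by (auto simp: v_def w_def)
    have "0 < g x"
    proof (cases "0 < w")
      case True
      consider "x < 0" | "x = 0" | "0 < x" by linarith
      then show ?thesis
      proof cases
        case 1
        have "(x - v) * g 0 < - v * g x" using concave[of 0 v x] zeros order vx 1 by simp
        moreover have "0 < (x - v) * g 0" using g0 True vx by simp
        ultimately have "0 < - v * g x" by linarith
        then show ?thesis using order by (simp add: mult_less_0_iff)
      next
        case 3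
        then show ?thesis using convex[of x w u] zeros order vx by (simp add: zero_less_mult_iff)
      qed (use g0 True in simp)
    next
      case False
      then show ?thesis using concave[of w v x] zeros order vx by (simp add: zero_less_mult_iff)
    qed
    then show ?thesis using vx by simp
  qed
  moreover have "g x / (x - v) = chord f v x - s"
    using chord_g[of v x] x zeros by (simp add: chord_def v_def)
  ultimately show ?thesis by (simp add: s_def v_def)
qed

text \<open>
  If there are two outgoing waves, the first one is a nonclassical shock. If the left incoming wave is a
  nonclassical shock, too, it can meet the second wave only if \<open>\<phi>s l \<le> r\<close>, which
  gives at most one outgoing wave. Otherwise an outgoing classical shock in second position makes the
  interaction exceptional, and an outgoing rarefaction means \<open>r < \<phi>b l\<close>. As
  \<open>\<phi>b\<close> is decreasing, such an \<open>r\<close> is reached only from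
  \<open>m > l\<close> or from \<open>m \<le> 0\<close>.
\<close>

lemma collision_pos:
  assumes l: "0 < l" and w1: "riemann \<phi>b \<phi>s l m = [w1]" and w2: "riemann \<phi>b \<phi>s m r = [w2]"
    and speeds: "chord f m r < chord f l m"
    and generic: "\<not> exceptional [w1, w2] (riemann \<phi>b \<phi>s l r)"
  shows "\<not> (kind w1 = Rarefaction \<and> kind w2 = Rarefaction) \<and>
      (\<exists>k. riemann \<phi>b \<phi>s l r = (if l = r then [] else [Wave k l r])) \<or>
    riemann \<phi>b \<phi>s l r = [Wave Nonclassical l (\<phi>b l), Wave Rarefaction (\<phi>b l) r] \<and> r < \<phi>b l \<and>
      (kind w1 = Rarefaction \<and> kind w2 \<noteq> Rarefaction \<and> l < m \<and> \<phi>b m \<le> r \<or> m \<le> 0 \<and> \<phi>b l < m)"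
proof -
  note out = riemann_pos[OF l, of r]
  have bl: "\<phi>b l < 0" "\<phi>b l < \<phi>s l" "\<phi>s l < l" using \<phi>b_neg \<phi>s_pos l by auto
  have mr: "m \<noteq> r" using riemann_single_states[OF w2] by simp
  from single_pos[OF l w1] consider
    (R) "kind w1 = Rarefaction" "l < m" | (N) "kind w1 = Nonclassical" "m = \<phi>b l" |
    (C) "kind w1 = Classical" "\<phi>s l \<le> m" "m < l" by blast
  then show ?thesis
  proof cases
    case R
    have bm: "\<phi>b m < \<phi>s m" "\<phi>s m < m" "\<phi>b m < \<phi>b l" using \<phi>s_pos[of m] \<phi>b_less[of l m] R l by auto
    have "\<not> m < r"
      using chord_less_chord[of f l r m, OF f_deriv] convex_right l R speeds by force
    then have r: "kind w2 = Nonclassical \<and> r = \<phi>b m \<or> kind w2 = Classical \<and> \<phi>s m \<le> r"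
      using single_pos[OF _ w2] R l by auto
    then show ?thesis
      using out generic R bm bl by (auto simp: exceptional_def split: if_splits)
  next
    case N
    have "\<phi>s l \<le> r"
      using nonclassical_slowest[OF l, of r] speeds mr N by force
    then show ?thesis using out N bl by auto
  next
    case C
    \<comment> \<open>a single wave from \<open>m \<in> {0<..<l}\<close> does not end below \<open>\<phi>b m\<close>, and \<open>\<phi>b l < \<phi>b m\<close>\<close>
    have m: "m \<le> 0" if "r < \<phi>b l"
    proof (rule ccontr)
      assume "\<not> m \<le> 0"
      then have "0 < m" by simp
      then show False
        using single_pos[OF _ w2] that \<phi>s_pos[of m] \<phi>b_less[of m l] C bl by auto
    qed
    show ?thesis
      using out generic C bl m by (cases "kind w2") (auto simp: exceptional_def split: if_splits)
  qed
qed

lemma collision_neg: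
  assumes l: "l < 0" and w1: "riemann \<phi>b \<phi>s l m = [w1]" and w2: "riemann \<phi>b \<phi>s m r = [w2]"
    and speeds: "chord f m r < chord f l m"
    and generic: "\<not> exceptional [w1, w2] (riemann \<phi>b \<phi>s l r)"
  shows "\<not> (kind w1 = Rarefaction \<and> kind w2 = Rarefaction) \<and>
      (\<exists>k. riemann \<phi>b \<phi>s l r = (if l = r then [] else [Wave k l r])) \<or>
    riemann \<phi>b \<phi>s l r = [Wave Nonclassical l (\<phi>b l), Wave Rarefaction (\<phi>b l) r] \<and> \<phi>b l < r \<and>
      (kind w1 = Rarefaction \<and> kind w2 \<noteq> Rarefaction \<and> m < l \<and> r \<le> \<phi>b m \<or> 0 \<le> m \<and> m < \<phi>b l)"
proof -
  interpret m: kinetic_solver "mirror f" "mirror \<phi>b" "mirror \<phi>s" by (rule mirrored)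
  have kind: "kind (mirror_wave w) = kind w" for w by (cases w) simp
  have inv: "mirror_wave (mirror_wave w) = w" for w by (cases w) simp
  have exc: "exceptional [mirror_wave w1, mirror_wave w2] (map mirror_wave ws) =
      exceptional [w1, w2] ws" for ws
    by (simp add: exceptional_def kind comp_def)
  have unmirror: "map mirror_wave ws = vs \<longleftrightarrow> ws = map mirror_wave vs" for ws vs
    by (auto simp: inv comp_def)
  have "\<not> (kind w1 = Rarefaction \<and> kind w2 = Rarefaction) \<and>
      (\<exists>k. map mirror_wave (riemann \<phi>b \<phi>s l r) = (if - l = - r then [] else [Wave k (- l) (- r)])) \<or>
    map mirror_wave (riemann \<phi>b \<phi>s l r) =
        [Wave Nonclassical (- l) (mirror \<phi>b (- l)), Wave Rarefaction (mirror \<phi>b (- l)) (- r)] \<and>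
      - r < mirror \<phi>b (- l) \<and>
      (kind w1 = Rarefaction \<and> kind w2 \<noteq> Rarefaction \<and> - l < - m \<and> mirror \<phi>b (- m) \<le> - r \<or>
       - m \<le> 0 \<and> mirror \<phi>b (- l) < - m)"
    using m.collision_pos[of "- l" "- m" "mirror_wave w1" "- r" "mirror_wave w2"]
      l speeds generic unfolding riemann_mirror chord_mirror exc kind w1 w2 by simp
  then show ?thesis unfolding unmirror by (auto simp: mirror_def)
qed

text \<open>
  From the left state \<open>0\<close> the solver issues one wave at most, so only the collision of two
  rarefactions remains to be excluded.
\<close>

lemma collision_zero:
  assumes w1: "riemann \<phi>b \<phi>s 0 m = [w1]" and w2: "riemann \<phi>b \<phi>s m r = [w2]"
    and speeds: "chord f m r < chord f 0 m"
  shows "\<not> (kind w1 = Rarefaction \<and> kind w2 = Rarefaction)"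
proof -
  have no_pos: "\<not> (kind w2 = Rarefaction)" if ks: "kinetic_solver f \<phi>b \<phi>s" and m: "0 < m"
      and w2: "riemann \<phi>b \<phi>s m r = [w2]" and speeds: "chord f m r < chord f 0 m"
    for f \<phi>b \<phi>s m r w2
  proof
    interpret kinetic_solver f \<phi>b \<phi>s by (rule ks)
    assume "kind w2 = Rarefaction"
    then have "m < r" using single_pos[OF m w2] by auto
    then show False
      using chord_less_chord[of f 0 r m, OF f_deriv] convex_right m speeds by force
  qed
  have kind: "kind (mirror_wave w) = kind w" for w by (cases w) simp
  have "m \<noteq> 0" using riemann_single_states[OF w1] by simp
  then consider "0 < m" | "m < 0" by linarith
  then show ?thesis
  proof cases
    case 1
    then show ?thesis using no_pos[OF kinetic_solver_axioms _ w2 speeds] by blast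
  next
    case 2
    then show ?thesis
      using no_pos[OF mirrored, of "- m" "- r" "mirror_wave w2"] w2 speeds
      unfolding riemann_mirror chord_mirror kind by simp
  qed
qed

end

section \<open>Collisions in normalized states\<close>

text \<open>
  A descent of \<open>h\<close> would, by the intermediate value theorem, make \<open>h\<close> take a
  value twice, which the expansion bound forbids.
\<close>

lemma expanding_nonneg_increasing:
  fixes h :: "real \<Rightarrow> real"
  assumes cont: "continuous_on {0..R} h" and zero: "h 0 = 0"
    and nonneg: "\<And>x. x \<in> {0..R} \<Longrightarrow> 0 \<le> h x"
    and expand: "\<And>x y. x \<in> {0..R} \<Longrightarrow> y \<in> {0..R} \<Longrightarrow> c * \<bar>x - y\<bar> \<le> \<bar>h x - h y\<bar>" and "0 < c"
    and xy: "0 \<le> x" "x \<le> y" "y \<le> R"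
  shows "c * (y - x) \<le> h y - h x"
proof -
  have "h x \<le> h y"
  proof (rule ccontr)
    assume less: "\<not> h x \<le> h y"
    have "continuous_on {0..x} h" using cont xy by (auto elim: continuous_on_subset)
    then obtain z where z: "0 \<le> z" "z \<le> x" "h z = h y"
      using IVT'[of h 0 "h y" x] zero nonneg[of y] less xy by auto
    have "c * \<bar>z - y\<bar> \<le> 0" using expand[of z y] z xy by auto
    then have "z = y" using \<open>0 < c\<close> by (simp add: mult_le_0_iff)
    then show False using z xy less by auto
  qed
  then show ?thesis using expand[of y x] xy by auto
qed

definition hat_pair :: "(real \<Rightarrow> real) \<Rightarrow> wave \<Rightarrow> real \<times> real" where
  "hat_pair \<phi>0 w = (hat \<phi>0 (lstate w), hat \<phi>0 (rstate w))"

locale dissipative_solver = kinetic_solver f \<phi>b \<phi>s for f \<phi>b \<phi>s :: "real \<Rightarrow> real" +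
  fixes \<phi>0 :: "real \<Rightarrow> real"
  assumes \<phi>0_less: "x < y \<Longrightarrow> \<phi>0 y < \<phi>0 x"
    and \<phi>0_involution [simp]: "\<phi>0 (\<phi>0 x) = x"
    and \<phi>0_0 [simp]: "\<phi>0 0 = 0"
    and dissipation_pos: "0 < u \<Longrightarrow> \<phi>0 u < \<phi>b u"
    and dissipation_neg: "u < 0 \<Longrightarrow> \<phi>b u < \<phi>0 u"
begin

lemma \<phi>0_less_iff: "\<phi>0 x < \<phi>0 y \<longleftrightarrow> y < x"
  using \<phi>0_less by (metis linorder_neqE_linordered_idom order_less_asym)

lemma \<phi>0_le_iff: "\<phi>0 x \<le> \<phi>0 y \<longleftrightarrow> y \<le> x"
  using \<phi>0_less_iff by (meson linorder_not_le)

lemma \<phi>0_less_swap: "\<phi>0 x < y \<longleftrightarrow> \<phi>0 y < x"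
  using \<phi>0_less_iff[of x "\<phi>0 y"] by simp

lemma \<phi>0_le_swap: "\<phi>0 x \<le> y \<longleftrightarrow> \<phi>0 y \<le> x"
  using \<phi>0_le_iff[of x "\<phi>0 y"] by simp

lemma hat_nonneg: "0 \<le> hat \<phi>0 u"
  using \<phi>0_less[of u 0] by (auto simp: hat_def intro: less_imp_le)

lemma hat_nonpos: "u \<le> 0 \<Longrightarrow> hat \<phi>0 u = \<phi>0 u"
  by (cases "u = 0") (auto simp: hat_def)

lemma hat_le_iff: "0 \<le> R \<Longrightarrow> hat \<phi>0 u \<le> R \<longleftrightarrow> u \<in> {\<phi>0 R..R}"
  using \<phi>0_le_swap[of u R] \<phi>0_le_iff[of R 0] by (auto simp: hat_def)

text \<open>
  A shock from \<open>a\<close> ends strictly between \<open>a\<close> and \<open>\<phi>0 a\<close>, and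
  these two have the same normalized state.
\<close>

lemma hat_kind:
  assumes w: "riemann \<phi>b \<phi>s a b = [w]"
  shows "kind w = Rarefaction \<Longrightarrow> hat \<phi>0 a < hat \<phi>0 b"
    and "kind w \<noteq> Rarefaction \<Longrightarrow> hat \<phi>0 b < hat \<phi>0 a"
proof -
  have "(kind w = Rarefaction \<longrightarrow> hat \<phi>0 a < hat \<phi>0 b) \<and> (kind w \<noteq> Rarefaction \<longrightarrow> hat \<phi>0 b < hat \<phi>0 a)"
  proof (cases a "0 :: real" rule: linorder_cases)
    case less
    have "kind w = Rarefaction \<and> b < a \<or> kind w \<noteq> Rarefaction \<and> a < b \<and> b < \<phi>0 a"
      using single_neg[OF less w] \<phi>s_neg[OF less] dissipation_neg[OF less] by auto
    then show ?thesis using less by (auto simp: hat_def \<phi>0_less_iff)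
  next
    case equal
    then show ?thesis using w \<phi>0_less_iff[of 0 b] riemann_zero[of b] by (auto simp: hat_def split: if_splits)
  next
    case greater
    have "kind w = Rarefaction \<and> a < b \<or> kind w \<noteq> Rarefaction \<and> b < a \<and> \<phi>0 a < b"
      using single_pos[OF greater w] \<phi>s_pos[OF greater] dissipation_pos[OF greater] by auto
    then show ?thesis using greater \<phi>0_less_swap[of a b] by (auto simp: hat_def)
  qed
  then show "kind w = Rarefaction \<Longrightarrow> hat \<phi>0 a < hat \<phi>0 b"
    "kind w \<noteq> Rarefaction \<Longrightarrow> hat \<phi>0 b < hat \<phi>0 a" by auto
qed

lemma hat_single_distinct: "riemann \<phi>b \<phi>s a b = [w] \<Longrightarrow> hat \<phi>0 a \<noteq> hat \<phi>0 b"
  using hat_kind by fastforce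

text \<open>
  The cases of the collision lemmas are matched with the three replacements. For \<open>l > 0\<close>
  the middle outgoing state \<open>\<phi>b l\<close> has the normalized value
  \<open>\<phi>0 (\<phi>b l)\<close>, for \<open>l < 0\<close> it is itself positive. Therefore, when a
  rarefaction crosses a shock, the loss of strength is at least an increment of
  \<open>u - \<phi>0 (\<phi>b u)\<close> in the first case and of \<open>\<phi>0 u - \<phi>b u\<close> in the second one.
\<close>

lemma collision_attenuates:
  assumes flux: "convex_flux f R L"
    and C: "0 < C" "C * L * R \<le> 1" "2 * C * L * R \<le> c" "0 < c"
    and gain_pos: "\<And>x y. 0 \<le> x \<Longrightarrow> x \<le> y \<Longrightarrow> y \<le> R \<Longrightarrow>
        c * (y - x) \<le> (y - \<phi>0 (\<phi>b y)) - (x - \<phi>0 (\<phi>b x))"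
    and gain_neg: "mirrored_RC2_or_RN [w1, w2] (riemann \<phi>b \<phi>s l r) \<Longrightarrow>
        (\<forall>x y. \<phi>0 R \<le> x \<longrightarrow> x \<le> y \<longrightarrow> y \<le> 0 \<longrightarrow>
          c * (\<phi>0 x - \<phi>0 y) \<le> (\<phi>0 x - \<phi>b x) - (\<phi>0 y - \<phi>b y))"
    and w1: "riemann \<phi>b \<phi>s l m = [w1]" and w2: "riemann \<phi>b \<phi>s m r = [w2]"
    and states: "hat \<phi>0 l \<le> R" "hat \<phi>0 m \<le> R" "hat \<phi>0 r \<le> R"
    and speeds: "chord f m r < chord f l m"
    and generic: "\<not> exceptional [w1, w2] (riemann \<phi>b \<phi>s l r)"
  shows "attenuates (pair_weight (chord f) C) (pairs_upto R)
    (map (hat_pair \<phi>0) [w1, w2]) (map (hat_pair \<phi>0) (riemann \<phi>b \<phi>s l r))"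
proof -
  interpret convex_flux f R L by (rule flux)
  let ?H = "hat \<phi>0"
  have R: "0 \<le> R" using states hat_nonneg[of l] by linarith
  have ins: "map (hat_pair \<phi>0) [w1, w2] = [(?H l, ?H m), (?H m, ?H r)]"
    using riemann_single_states[OF w1] riemann_single_states[OF w2] by (simp add: hat_pair_def)
  have ne: "?H l \<noteq> ?H m" "?H m \<noteq> ?H r" using hat_single_distinct w1 w2 by auto
  have one: ?thesis if k: "riemann \<phi>b \<phi>s l r = (if l = r then [] else [Wave k l r])"
    and "\<not> (kind w1 = Rarefaction \<and> kind w2 = Rarefaction)" for k
  proof -
    have "l \<noteq> r \<Longrightarrow> ?H l \<noteq> ?H r" using hat_single_distinct[of l r] k by auto
    then have out: "map (hat_pair \<phi>0) (riemann \<phi>b \<phi>s l r) =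
        (if ?H l = ?H r then [] else [(?H l, ?H r)])"
      using k by (auto simp: hat_pair_def)
    have "\<not> (?H l < ?H m \<and> ?H m < ?H r)"
      using hat_kind(2)[OF w1] hat_kind(2)[OF w2] that(2) by fastforce
    then show ?thesis unfolding ins
      using states hat_nonneg ne by (intro attenuates_single[OF C(1,2) _ _ _ _ _ _ out]) auto
  qed
  show ?thesis
  proof (cases l "0 :: real" rule: linorder_cases)
    case less
    consider k where "\<not> (kind w1 = Rarefaction \<and> kind w2 = Rarefaction)"
        "riemann \<phi>b \<phi>s l r = (if l = r then [] else [Wave k l r])"
      | (NR) "riemann \<phi>b \<phi>s l r = [Wave Nonclassical l (\<phi>b l), Wave Rarefaction (\<phi>b l) r]"
        "\<phi>b l < r" "kind w1 = Rarefaction \<and> kind w2 \<noteq> Rarefaction \<and> m < l \<and> r \<le> \<phi>b m \<or>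
          0 \<le> m \<and> m < \<phi>b l"
      using collision_neg[OF less w1 w2 speeds generic] by blast
    then show ?thesis
    proof cases
      case 1
      then show ?thesis using one by blast
    next
      case NR
      have k: "0 < \<phi>b l" "\<phi>b l < \<phi>0 l" using \<phi>b_pos dissipation_neg less by auto
      have H: "?H l = \<phi>0 l" "?H (\<phi>b l) = \<phi>b l" "?H r = r"
        using less k NR by (auto simp: hat_def)
      have out: "map (hat_pair \<phi>0) (riemann \<phi>b \<phi>s l r) = [(\<phi>0 l, \<phi>b l), (\<phi>b l, r)]"
        using NR(1) H by (simp add: hat_pair_def)
      show ?thesis
      proof (cases "m < l")
        case True
        then have m: "?H m = \<phi>0 m" "kind w1 = Rarefaction" "kind w2 \<noteq> Rarefaction" "r \<le> \<phi>b m"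
          using NR k less by (auto simp: hat_def)
        have "mirrored_RC2_or_RN [w1, w2] (riemann \<phi>b \<phi>s l r)"
          using m NR(1) less riemann_single_states(1)[OF w1]
          by (cases "kind w2") (auto simp: mirrored_RC2_or_RN_def)
        then have "c * (\<phi>0 m - \<phi>0 l) \<le> (\<phi>0 m - \<phi>b m) - (\<phi>0 l - \<phi>b l)"
          using gain_neg less True states(2) m(1) \<phi>0_le_swap[of m R] by auto
        then have "c * (\<phi>0 m - \<phi>0 l) \<le> (\<phi>0 m - r) - (\<phi>0 l - \<phi>b l)" using m by linarith
        moreover have "r < \<phi>0 m" using hat_kind(2)[OF w2] m H by simp
        ultimately show ?thesis unfolding ins out unfolding H m(1)
          using k NR(2) True states m(1) by (intro attenuates_rarefaction_transmitted[OF C]) (auto simp: \<phi>0_less_iff)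
      next
        case False
        then have "0 \<le> m" "m < \<phi>b l" using NR by auto
        then show ?thesis unfolding ins out unfolding H hat_def[of _ m]
          using k NR(2) states H by (auto intro!: attenuates_raise_bottom[OF C(1,2)])
      qed
    qed
  next
    case equal
    have "\<exists>k. riemann \<phi>b \<phi>s l r = (if l = r then [] else [Wave k l r])"
      using riemann_zero[of r] equal by auto
    then show ?thesis using one collision_zero w1 w2 speeds equal by blast
  next
    case greater
    consider k where "\<not> (kind w1 = Rarefaction \<and> kind w2 = Rarefaction)"
        "riemann \<phi>b \<phi>s l r = (if l = r then [] else [Wave k l r])"
      | (NR) "riemann \<phi>b \<phi>s l r = [Wave Nonclassical l (\<phi>b l), Wave Rarefaction (\<phi>b l) r]"
        "r < \<phi>b l" "kind w1 = Rarefaction \<and> kind w2 \<noteq> Rarefaction \<and> l < m \<and> \<phi>b m \<le> r \<or>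
          m \<le> 0 \<and> \<phi>b l < m"
      using collision_pos[OF greater w1 w2 speeds generic] by blast
    then show ?thesis
    proof cases
      case 1
      then show ?thesis using one by blast
    next
      case NR
      have k: "\<phi>b l < 0" "\<phi>0 (\<phi>b l) < l" "0 < \<phi>0 (\<phi>b l)"
        using \<phi>b_neg dissipation_pos greater \<phi>0_less[of "\<phi>b l" 0] \<phi>0_less[of "\<phi>0 l" "\<phi>b l"] by auto
      have H: "?H l = l" "?H (\<phi>b l) = \<phi>0 (\<phi>b l)" "?H r = \<phi>0 r"
        using greater k NR by (auto simp: hat_def)
      have out: "map (hat_pair \<phi>0) (riemann \<phi>b \<phi>s l r) = [(l, \<phi>0 (\<phi>b l)), (\<phi>0 (\<phi>b l), \<phi>0 r)]"
        using NR(1) H by (simp add: hat_pair_def)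
      show ?thesis
      proof (cases "l < m")
        case True
        then have m: "?H m = m" "kind w2 \<noteq> Rarefaction" "\<phi>b m \<le> r"
          using NR k greater by (auto simp: hat_def)
        have "c * (m - l) \<le> (m - \<phi>0 (\<phi>b m)) - (l - \<phi>0 (\<phi>b l))"
          using gain_pos[of l m] greater True states m by simp
        moreover have "\<phi>0 r \<le> \<phi>0 (\<phi>b m)" using m by (simp add: \<phi>0_le_iff)
        ultimately have "c * (m - l) \<le> (m - \<phi>0 r) - (l - \<phi>0 (\<phi>b l))" by linarith
        moreover have "\<phi>0 r < m" using hat_kind(2)[OF w2] m H by simp
        ultimately show ?thesis unfolding ins out unfolding H m(1)
          using k NR(2) True states m(1) by (intro attenuates_rarefaction_transmitted[OF C]) (auto simp: \<phi>0_less_iff)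
      next
        case False
        then have m: "m \<le> 0" "\<phi>b l < m" using NR by auto
        then have "0 \<le> \<phi>0 m" using \<phi>0_le_iff[of 0 m] by simp
        then show ?thesis unfolding ins out unfolding H hat_nonpos[OF m(1)]
          using k NR(2) states H m by (intro attenuates_raise_bottom[OF C(1,2)]) (auto simp: \<phi>0_less_iff)
      qed
    qed
  qed
qed

end

section \<open>Step functions and the functional\<close>

definition end_state :: "real \<Rightarrow> wave list \<Rightarrow> real" where
  "end_state v ws = last (v # map rstate ws)"

lemma end_state_append_Cons [simp]: "end_state v (ws @ [w]) = rstate w"
  by (simp add: end_state_def)

lemma chained_append: "chained v (ws @ zs) \<longleftrightarrow> chained v ws \<and> chained (end_state v ws) zs"
  by (induction ws arbitrary: v) (auto simp: end_state_def)

lemma step_fun_end_state: "step_fun v fs x = end_state v (map snd (filter (\<lambda>p. fst p \<le> x) fs))"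
  by (simp add: step_fun_def end_state_def comp_def)

lemma step_fun_left:
  "\<forall>\<^sub>F x in at_left y. step_fun v fs x = end_state v (map snd (filter (\<lambda>p. fst p < y) fs))"
proof -
  have "\<forall>\<^sub>F x in at_left y. fst p \<le> x \<longleftrightarrow> fst p < y" for p :: front
  proof (cases "fst p < y")
    case True
    then have "\<forall>\<^sub>F x in at_left y. fst p < x" by (intro order_tendstoD(1)[OF tendsto_ident_at])
    then show ?thesis using True by (auto elim: eventually_mono)
  next
    case False
    have "\<forall>\<^sub>F x in at_left y. x < y" by (simp add: eventually_at_filter)
    then show ?thesis using False by (auto elim: eventually_mono)
  qed
  then have "\<forall>\<^sub>F x in at_left y. \<forall>p\<in>set fs. fst p \<le> x \<longleftrightarrow> fst p < y"
    by (simp add: eventually_ball_finite)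
  then show ?thesis
    by (rule eventually_mono) (auto simp: step_fun_end_state cong: filter_cong)
qed

lemma step_fun_right: "\<forall>\<^sub>F x in at_right y. step_fun v fs x = step_fun v fs y"
proof -
  have "\<forall>\<^sub>F x in at_right y. fst p \<le> x \<longleftrightarrow> fst p \<le> y" for p :: front
  proof (cases "fst p \<le> y")
    case True
    have "\<forall>\<^sub>F x in at_right y. y < x" by (simp add: eventually_at_filter)
    then show ?thesis using True by (auto elim: eventually_mono)
  next
    case False
    then have "\<forall>\<^sub>F x in at_right y. x < fst p" by (intro order_tendstoD(2)[OF tendsto_ident_at]) auto
    then show ?thesis using False by (auto elim: eventually_mono)
  qed
  then have "\<forall>\<^sub>F x in at_right y. \<forall>p\<in>set fs. fst p \<le> x \<longleftrightarrow> fst p \<le> y"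
    by (simp add: eventually_ball_finite)
  then show ?thesis
    by (rule eventually_mono) (auto simp: step_fun_end_state cong: filter_cong)
qed

lemma left_limit_step_fun:
  "left_limit (step_fun v fs) y = end_state v (map snd (filter (\<lambda>p. fst p < y) fs))"
  unfolding left_limit_def using step_fun_left
  by (intro tendsto_Lim tendsto_eventually) (auto simp: trivial_limit_at_left_real)

lemma right_limit_step_fun: "right_limit (step_fun v fs) y = step_fun v fs y"
  unfolding right_limit_def using step_fun_right
  by (intro tendsto_Lim tendsto_eventually) (auto simp: trivial_limit_at_right_real)

lemma step_fun_limits_at_front:
  assumes sorted: "sorted_wrt (<) (map fst fs)" and chain: "chained v (map snd fs)"
    and p: "(y, w) \<in> set fs"
  shows "left_limit (step_fun v fs) y = lstate w" "step_fun v fs y = rstate w"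
    "right_limit (step_fun v fs) y = rstate w"
proof -
  obtain A B where fs: "fs = A @ (y, w) # B" using split_list[OF p] by blast
  have AB: "\<forall>p\<in>set A. fst p < y" "\<forall>p\<in>set B. y < fst p"
    using sorted unfolding fs by (auto simp: sorted_wrt_append)
  have A: "filter (\<lambda>p. fst p < y) A = A" "filter (\<lambda>p. fst p \<le> y) A = A"
    using AB by (auto simp: filter_id_conv)
  have B: "filter (\<lambda>p. fst p < y) B = []" "filter (\<lambda>p. fst p \<le> y) B = []"
    using AB by (auto simp: filter_empty_conv)
  show "left_limit (step_fun v fs) y = lstate w"
    using chain unfolding left_limit_step_fun fs by (simp add: A B chained_append)
  show "step_fun v fs y = rstate w"
    unfolding step_fun_end_state fs by (simp add: A B)
  then show "right_limit (step_fun v fs) y = rstate w" by (simp add: right_limit_step_fun)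
qed

lemma jumps_step_fun:
  assumes "sorted_wrt (<) (map fst fs)" "chained v (map snd fs)"
    and "\<And>p. p \<in> set fs \<Longrightarrow> lstate (snd p) \<noteq> rstate (snd p)"
  shows "jumps (step_fun v fs) = set (map fst fs)"
proof (intro set_eqI iffI)
  fix y assume "y \<in> set (map fst fs)"
  then obtain w where "(y, w) \<in> set fs" by auto
  then show "y \<in> jumps (step_fun v fs)"
    using step_fun_limits_at_front[OF assms(1,2)] assms(3) by (fastforce simp: jumps_def)
next
  fix y assume y: "y \<in> jumps (step_fun v fs)"
  show "y \<in> set (map fst fs)"
  proof (rule ccontr)
    assume "y \<notin> set (map fst fs)"
    then have "filter (\<lambda>p. fst p < y) fs = filter (\<lambda>p. fst p \<le> y) fs"
      by (intro filter_cong) force+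
    then show False
      using y by (simp add: jumps_def left_limit_step_fun right_limit_step_fun step_fun_end_state)
  qed
qed

lemma potential_map: "potential g (map h xs) = potential (\<lambda>x y. g (h x) (h y)) xs"
  by (induction xs) (auto simp: comp_def)

lemma potential_cong:
  assumes "\<And>x y. x \<in> set xs \<Longrightarrow> y \<in> set xs \<Longrightarrow> g x y = h x y"
  shows "potential g xs = potential h xs"
  using assms
proof (induction xs)
  case (Cons x xs)
  then show ?case by (simp cong: map_cong)
qed simp

lemma sum_ordered_pairs:
  fixes xs :: "real list"
  assumes "sorted_wrt (<) xs"
  shows "(\<Sum>(x, y)\<in>{(x, y). x \<in> set xs \<and> y \<in> set xs \<and> x < y}. g x y) = potential g xs"
  using assms
proof (induction xs)
  case (Cons x xs)
  let ?S = "{(x, y). x \<in> set xs \<and> y \<in> set xs \<and> x < y}"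
  have less: "\<forall>y\<in>set xs. x < y" and dist: "distinct xs"
    using Cons.prems strict_sorted_iff by auto
  have split: "{(y, z). y \<in> set (x # xs) \<and> z \<in> set (x # xs) \<and> y < z} = Pair x ` set xs \<union> ?S"
    using less by force
  have fin: "finite ?S" by (rule finite_subset[of _ "set xs \<times> set xs"]) auto
  have "(\<Sum>(y, z)\<in>Pair x ` set xs \<union> ?S. g y z) =
      (\<Sum>(y, z)\<in>Pair x ` set xs. g y z) + (\<Sum>(y, z)\<in>?S. g y z)"
    using less fin by (intro sum.union_disjoint) auto
  also have "(\<Sum>(y, z)\<in>Pair x ` set xs. g y z) = (\<Sum>z\<leftarrow>xs. g x z)"
    using dist by (subst sum.reindex) (auto simp: inj_on_def sum_list_distinct_conv_sum_set)
  finally show ?case using Cons split by simp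
qed simp

lemma strength_hat: "strength \<phi>0 a b = \<bar>hat \<phi>0 a - hat \<phi>0 b\<bar>"
  by (simp add: strength_def hat_def)

text \<open>
  The positions of the fronts enter the functional through their order only, so it is constant between
  interactions.
\<close>

lemma Q_pos_step_fun:
  assumes sorted: "sorted_wrt (<) (map fst fs)" and chain: "chained v (map snd fs)"
    and jump: "\<And>p. p \<in> set fs \<Longrightarrow> lstate (snd p) \<noteq> rstate (snd p)"
  shows "Q_pos f \<phi>0 C (step_fun v fs) =
    potential (pair_weight (chord f) C) (map (hat_pair \<phi>0) (map snd fs))"
proof -
  let ?w = "step_fun v fs"
  let ?g = "\<lambda>x y. theta f \<phi>0 C ?w x y * sigma \<phi>0 ?w x * sigma \<phi>0 ?w y"
  have J: "jumps ?w = set (map fst fs)"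
    using jumps_step_fun[OF sorted chain] jump by blast
  have g: "?g (fst p) (fst q) =
      pair_weight (chord f) C (hat_pair \<phi>0 (snd p)) (hat_pair \<phi>0 (snd q))"
    if "p \<in> set fs" "q \<in> set fs" for p q
  proof -
    have "fst p \<in> jumps ?w" "fst q \<in> jumps ?w" using that J by auto
    moreover have "left_limit ?w (fst p) = lstate (snd p)" "right_limit ?w (fst p) = rstate (snd p)"
      "left_limit ?w (fst q) = lstate (snd q)" "right_limit ?w (fst q) = rstate (snd q)"
      using step_fun_limits_at_front[OF sorted chain] that by (metis prod.collapse)+
    ultimately show ?thesis
      by (simp add: theta_def sigma_def same_monotonicity_def normalized_speed_def
          pair_weight_def hat_pair_def strength_hat)
  qed
  have "Q_pos f \<phi>0 C ?w = potential ?g (map fst fs)"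
    unfolding Q_pos_def J using sum_ordered_pairs[OF sorted, of ?g] by simp
  also have "\<dots> = potential (\<lambda>p q. ?g (fst p) (fst q)) fs" by (rule potential_map)
  also have "\<dots> = potential (\<lambda>p q. pair_weight (chord f) C (hat_pair \<phi>0 (snd p)) (hat_pair \<phi>0 (snd q))) fs"
    by (rule potential_cong[OF g])
  also have "\<dots> = potential (pair_weight (chord f) C) (map (hat_pair \<phi>0) (map snd fs))"
    by (simp add: potential_map)
  finally show ?thesis .
qed

section \<open>Groups of fronts at one position\<close>

lemma sorted_split_at:
  fixes fs :: "(real \<times> 'a) list"
  assumes "sorted_wrt (\<le>) (map fst fs)"
  shows "fs = filter (\<lambda>p. fst p < y) fs @ filter (\<lambda>p. fst p = y) fs @ filter (\<lambda>p. y < fst p) fs"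
  using assms
proof (induction fs)
  case (Cons p fs)
  then have IH: "fs = filter (\<lambda>p. fst p < y) fs @ filter (\<lambda>p. fst p = y) fs @ filter (\<lambda>p. y < fst p) fs"
    and le: "\<forall>q\<in>set fs. fst p \<le> fst q" by auto
  have lt: "filter (\<lambda>p. fst p < y) fs = []" if "y \<le> fst p" using le that by (fastforce simp: filter_empty_conv)
  have eq: "filter (\<lambda>p. fst p = y) fs = []" if "y < fst p" using le that by (fastforce simp: filter_empty_conv)
  consider "fst p < y" | "fst p = y" | "y < fst p" by linarith
  then show ?case using IH lt eq by cases auto
qed simp

lemma waves_grouped:
  assumes "sorted_wrt (<) ys" "fst ` set fs \<subseteq> set ys" "sorted_wrt (\<le>) (map fst fs)"
  shows "map snd fs = concat (map (waves_at fs) ys)"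
  using assms
proof (induction ys arbitrary: fs)
  case (Cons y ys)
  let ?gs = "filter (\<lambda>p. y < fst p) fs"
  have "\<forall>p\<in>set fs. y \<le> fst p" using Cons.prems by fastforce
  then have "filter (\<lambda>p. fst p < y) fs = []" by (fastforce simp: filter_empty_conv)
  then have fs: "fs = filter (\<lambda>p. fst p = y) fs @ ?gs"
    using sorted_split_at[OF Cons.prems(3), of y] by simp
  have "map snd ?gs = concat (map (waves_at ?gs) ys)"
  proof (rule Cons.IH)
    show "sorted_wrt (<) ys" using Cons.prems by simp
    show "fst ` set ?gs \<subseteq> set ys" using Cons.prems by fastforce
    show "sorted_wrt (\<le>) (map fst ?gs)"
      using Cons.prems(3) by (simp add: sorted_wrt_map sorted_wrt_filter)
  qed
  also have "map (waves_at ?gs) ys = map (waves_at fs) ys"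
  proof (rule map_cong)
    fix z assume "z \<in> set ys"
    then have "y < z" using Cons.prems by simp
    then show "waves_at ?gs z = waves_at fs z"
      by (auto simp: waves_at_def intro!: arg_cong[of _ _ "map snd"] filter_cong)
  qed simp
  finally show ?case
    by (subst fs) (simp add: waves_at_def)
qed simp

text \<open>
  Interactions may take place at several positions at once. The groups are replaced one by one from the
  left, each within a context of groups that are already or not yet replaced.
\<close>

lemma potential_grouped_less:
  assumes each: "\<And>y. y \<in> set ys \<Longrightarrow> A y = B y \<or> attenuates g Z (A y) (B y)"
    and Z: "\<And>y. y \<in> set ys \<Longrightarrow> set (A y) \<subseteq> Z \<and> set (B y) \<subseteq> Z"
    and y0: "y0 \<in> set ys" "attenuates g Z (A y0) (B y0)"
  shows "potential g (concat (map B ys)) < potential g (concat (map A ys))"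
proof -
  have "potential g (pre @ concat (map B ys)) \<le> potential g (pre @ concat (map A ys)) \<and>
    ((\<exists>y\<in>set ys. attenuates g Z (A y) (B y)) \<longrightarrow>
      potential g (pre @ concat (map B ys)) < potential g (pre @ concat (map A ys)))"
    if "set pre \<subseteq> Z" for pre
    using each Z that
  proof (induction ys arbitrary: pre)
    case (Cons y ys)
    have IH: "potential g ((pre @ B y) @ concat (map B ys)) \<le> potential g ((pre @ B y) @ concat (map A ys)) \<and>
      ((\<exists>y\<in>set ys. attenuates g Z (A y) (B y)) \<longrightarrow>
      potential g ((pre @ B y) @ concat (map B ys)) < potential g ((pre @ B y) @ concat (map A ys)))"
      using Cons.prems by (intro Cons.IH) auto
    have "set (concat (map A ys)) \<subseteq> Z" using Cons.prems(2) by force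
    then have "attenuates g Z (A y) (B y) \<Longrightarrow>
        potential g (pre @ B y @ concat (map A ys)) < potential g (pre @ A y @ concat (map A ys))"
      using Cons.prems(3) by (intro attenuates_in_context) auto
    then show ?case using IH Cons.prems(1)[of y] by auto
  qed simp
  from this[of "[]"] show ?thesis using y0 by auto
qed

lemma chained_group:
  assumes sorted: "sorted_wrt (\<le>) (map fst fs)" and chain: "chained v (map snd fs)"
  shows "chained (end_state v (map snd (filter (\<lambda>p. fst p < y) fs))) (waves_at fs y)"
  using chain sorted_split_at[OF sorted, of y]
  by (metis chained_append map_append waves_at_def)

lemma map_snd_advance: "map snd (advance f \<tau> fs) = map snd fs"
  by (auto simp: advance_def)

lemma sorted_advance_iff:
  "sorted_wrt (<) (map fst (advance f \<tau> fs)) \<longleftrightarrow>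
    sorted_wrt (\<lambda>p q. fst p + chord f (lstate (snd p)) (rstate (snd p)) * \<tau>
      < fst q + chord f (lstate (snd q)) (rstate (snd q)) * \<tau>) fs"
  by (simp add: advance_def sorted_wrt_map case_prod_beta)

text \<open>
  Strict order of the positions at nearby times passes to weak order in the limit.
\<close>

lemma fronts_along_sorted:
  assumes fr: "fronts_along T f \<phi>b \<phi>s u t v fs" and T: "T \<noteq> bot" "T \<le> at t"
  shows "sorted_wrt (\<le>) (map fst fs)"
proof -
  let ?x = "\<lambda>p s. fst p + chord f (lstate (snd p)) (rstate (snd p)) * (s - t)"
  have ev: "\<forall>\<^sub>F s in T. sorted_wrt (\<lambda>p q. ?x p s < ?x q s) fs"
    using fr unfolding fronts_along_def sorted_advance_iff by (auto elim: eventually_mono)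
  have lim: "(?x p \<longlongrightarrow> fst p) T" for p
  proof (rule tendsto_mono[OF T(2)])
    have "(?x p \<longlongrightarrow> ?x p t) (at t)" by (intro tendsto_intros)
    then show "(?x p \<longlongrightarrow> fst p) (at t)" by simp
  qed
  have "fst (fs ! i) \<le> fst (fs ! j)" if "i < j" "j < length fs" for i j
  proof (rule tendsto_le[OF T(1) lim lim])
    show "\<forall>\<^sub>F s in T. ?x (fs ! i) s \<le> ?x (fs ! j) s"
      using ev by eventually_elim (use that in \<open>auto simp: sorted_wrt_iff_nth_less intro: less_imp_le\<close>)
  qed
  then show ?thesis by (simp add: sorted_wrt_iff_nth_less)
qed

text \<open>
  Fronts that share a position at time \<open>t\<close> were strictly ordered before, so the left one is
  faster.
\<close>

lemma colliding_speeds: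
  assumes fr: "fronts_along (at_left t) f \<phi>b \<phi>s u t v fs" and g: "waves_at fs y = [w1, w2]"
  shows "chord f (lstate w2) (rstate w2) < chord f (lstate w1) (rstate w1)" "rstate w1 = lstate w2"
proof -
  have "\<forall>\<^sub>F s in at_left t. s < t \<and> sorted_wrt (<) (map fst (advance f (s - t) fs))"
    using fr unfolding fronts_along_def by (auto simp: eventually_at_filter elim: eventually_mono)
  then obtain s where s: "s < t" "sorted_wrt (<) (map fst (advance f (s - t) fs))"
    using eventually_happens'[of "at_left t"] trivial_limit_at_left_real[of t] by blast
  obtain p q where pq: "filter (\<lambda>p. fst p = y) fs = [p, q]" "w1 = snd p" "w2 = snd q"
    using g by (auto simp: waves_at_def map_eq_Cons_conv)
  have "p \<in> set (filter (\<lambda>p. fst p = y) fs)" "q \<in> set (filter (\<lambda>p. fst p = y) fs)"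
    unfolding pq by auto
  then have y: "fst p = y" "fst q = y" by auto
  have "chord f (lstate w1) (rstate w1) * (s - t) < chord f (lstate w2) (rstate w2) * (s - t)"
    using sorted_wrt_filter[OF s(2)[unfolded sorted_advance_iff], of "\<lambda>p. fst p = y"] y pq by simp
  then show "chord f (lstate w2) (rstate w2) < chord f (lstate w1) (rstate w1)"
    using s(1) by (simp add: mult_less_cancel_right)
  have "sorted_wrt (\<le>) (map fst fs)"
    by (rule fronts_along_sorted[OF fr]) (auto simp: trivial_limit_at_left_real at_le)
  from chained_group[OF this, of v y] show "rstate w1 = lstate w2"
    using fr g by (simp add: fronts_along_def)
qed

section \<open>An invariant region for front-tracking approximations\<close>

text \<open>
  The infimum of the exceptional times would be neither exceptional nor a limit of later exceptional
  times.
\<close>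

lemma real_time_induct:
  fixes P :: "real \<Rightarrow> bool"
  assumes start: "P 0" "\<forall>\<^sub>F s in at_right 0. P s"
    and step: "\<And>t. 0 < t \<Longrightarrow> (\<And>s. 0 \<le> s \<Longrightarrow> s < t \<Longrightarrow> P s) \<Longrightarrow> P t \<and> (\<forall>\<^sub>F s in at_right t. P s)"
    and t: "0 \<le> t"
  shows "P t"
proof (rule ccontr)
  define S where "S = {s. 0 \<le> s \<and> \<not> P s}"
  assume "\<not> P t"
  then have ne: "S \<noteq> {}" using t by (auto simp: S_def)
  have bdd: "bdd_below S" by (auto simp: S_def)
  have inf0: "0 \<le> Inf S" using ne by (auto simp: S_def intro!: cInf_greatest)
  have below: "P s" if "0 \<le> s" "s < Inf S" for s
    using that cInf_lower[OF _ bdd, of s] by (auto simp: S_def not_less)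
  have "P (Inf S) \<and> (\<forall>\<^sub>F s in at_right (Inf S). P s)"
    using start step[OF _ below] inf0 by (cases "Inf S = 0") auto
  then obtain b where b: "Inf S < b" "\<And>s. Inf S \<le> s \<Longrightarrow> s < b \<Longrightarrow> P s"
    unfolding eventually_at_right_field by (metis order_le_less)
  have "b \<le> Inf S"
  proof (rule cInf_greatest[OF ne])
    fix s assume s: "s \<in> S"
    then have "Inf S \<le> s" by (rule cInf_lower[OF _ bdd])
    then show "b \<le> s" using b(2)[of s] s by (force simp: S_def)
  qed
  then show False using b by simp
qed

lemma step_fun_in:
  assumes "v \<in> J" "\<And>p. p \<in> set fs \<Longrightarrow> rstate (snd p) \<in> J"
  shows "step_fun v fs x \<in> J"
proof -
  have "step_fun v fs x \<in> set (v # map (rstate \<circ> snd) (filter (\<lambda>p. fst p \<le> x) fs))"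
    unfolding step_fun_def by (rule last_in_set) simp
  then show ?thesis using assms by auto
qed

lemma step_fun_base_in:
  assumes "\<And>x. step_fun v fs x \<in> J"
  shows "v \<in> J"
proof -
  obtain x where "\<forall>p\<in>set fs. x < fst p"
  proof
    show "\<forall>p\<in>set fs. Min (insert 0 (fst ` set fs)) - 1 < fst p"
    proof
      fix p assume "p \<in> set fs"
      then have "Min (insert 0 (fst ` set fs)) \<le> fst p" by (intro Min_le) auto
      then show "Min (insert 0 (fst ` set fs)) - 1 < fst p" by simp
    qed
  qed
  then have "filter (\<lambda>p. fst p \<le> x) fs = []" by (fastforce simp: filter_empty_conv)
  then show ?thesis using assms[of x] by (simp add: step_fun_def)
qed

lemma chained_states_in:
  assumes "chained v ws" "v \<in> J" "\<And>w. w \<in> set ws \<Longrightarrow> rstate w \<in> J" "w \<in> set ws"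
  shows "lstate w \<in> J"
  using assms by (induction ws arbitrary: v) auto

lemma rarefaction_fronts_between:
  assumes "rarefaction_fronts \<phi>0 \<epsilon> a b ws" "w \<in> set ws" "a \<in> {m..M}" "b \<in> {m..M}"
  shows "rstate w \<in> {m..M}"
proof -
  obtain vs where vs: "2 \<le> length vs" "hd vs = a" "last vs = b"
    "sorted_wrt (<) vs \<or> sorted_wrt (>) vs"
    "ws = map2 (Wave Rarefaction) (butlast vs) (tl vs)"
    using assms(1) by (auto simp: rarefaction_fronts_def)
  have "rstate w \<in> set (tl vs)" using assms(2) vs(5) by (auto dest: set_zip_rightD)
  then obtain i where i: "i < length vs" "vs ! i = rstate w"
    by (metis in_set_conv_nth list.set_sel(2) list.sel(2))
  have ends: "a = vs ! 0" "b = vs ! (length vs - 1)"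
    using vs(1-3) hd_conv_nth[of vs] last_conv_nth[of vs] by fastforce+
  from vs(4) show ?thesis
  proof
    assume "sorted_wrt (<) vs"
    then have "sorted vs" by (simp add: strict_sorted_imp_sorted)
    then have "a \<le> vs ! i" "vs ! i \<le> b"
      unfolding ends using i(1) sorted_nth_mono[of vs 0 i] sorted_nth_mono[of vs i "length vs - 1"] by auto
    then show ?thesis using i assms by auto
  next
    assume s: "sorted_wrt (>) vs"
    have "vs ! k \<le> vs ! j" if "j \<le> k" "k < length vs" for j k
      using sorted_wrt_nth_less[OF s, of j k] that by (cases "j = k") auto
    from this[of 0 i] this[of i "length vs - 1"] have "vs ! i \<le> a" "b \<le> vs ! i"
      unfolding ends using i by auto
    then show ?thesis using i assms by auto
  qed
qed

lemma discretization_between: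
  assumes "discretization \<phi>0 \<epsilon> ws ws'" "w \<in> set ws'"
    and "\<And>x. x \<in> set ws \<Longrightarrow> lstate x \<in> {m..M} \<and> rstate x \<in> {m..M}"
  shows "rstate w \<in> {m..M}"
proof -
  obtain wss where wss: "ws' = concat wss"
    "list_all2 (\<lambda>w xs. if kind w = Rarefaction
        then rarefaction_fronts \<phi>0 \<epsilon> (lstate w) (rstate w) xs else xs = [w]) ws wss"
    using assms(1) by (auto simp: discretization_def)
  then obtain xs where "xs \<in> set wss" "w \<in> set xs" using assms(2) by auto
  then obtain i where i: "i < length ws" "w \<in> set (wss ! i)"
    using wss(2) by (auto simp: in_set_conv_nth list_all2_conv_all_nth)
  then have "if kind (ws ! i) = Rarefaction
      then rarefaction_fronts \<phi>0 \<epsilon> (lstate (ws ! i)) (rstate (ws ! i)) (wss ! i) else wss ! i = [ws ! i]"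
    using wss(2) by (auto simp: list_all2_conv_all_nth)
  then show ?thesis
    using i assms(3)[of "ws ! i"] rarefaction_fronts_between[of \<phi>0 \<epsilon> _ _ "wss ! i" w m M]
    by (auto split: if_splits)
qed

lemma fronts_along_single:
  assumes "fronts_along T f \<phi>b \<phi>s u t v fs" "p \<in> set fs"
  shows "riemann \<phi>b \<phi>s (lstate (snd p)) (rstate (snd p)) = [snd p]"
  using assms by (auto simp: fronts_along_def)

lemma fronts_along_states_in:
  assumes fr: "fronts_along T f \<phi>b \<phi>s u t v fs" and T: "T \<noteq> bot"
    and ev: "\<forall>\<^sub>F s in T. \<forall>x. u s x \<in> J"
  shows "v \<in> J" "p \<in> set fs \<Longrightarrow> lstate (snd p) \<in> J \<and> rstate (snd p) \<in> J"
proof -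
  have "\<forall>\<^sub>F s in T. (\<forall>x. u s x \<in> J) \<and> sorted_wrt (<) (map fst (advance f (s - t) fs)) \<and>
      u s = step_fun v (advance f (s - t) fs)"
    using fr ev unfolding fronts_along_def by (auto elim: eventually_elim2)
  then obtain s where s: "\<And>x. u s x \<in> J" "sorted_wrt (<) (map fst (advance f (s - t) fs))"
      "u s = step_fun v (advance f (s - t) fs)"
    using eventually_happens'[OF T] by blast
  have chain: "chained v (map snd fs)" using fr by (simp add: fronts_along_def)
  show v: "v \<in> J" using step_fun_base_in s(1) unfolding s(3) by blast
  have r: "rstate (snd p) \<in> J" if p: "p \<in> set fs" for p
  proof -
    have "snd p \<in> set (map snd (advance f (s - t) fs))" using p by (simp add: map_snd_advance)
    then obtain y where "(y, snd p) \<in> set (advance f (s - t) fs)" by auto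
    then have "u s y = rstate (snd p)"
      using step_fun_limits_at_front(2)[OF s(2)] chain unfolding s(3) by (simp add: map_snd_advance)
    then show ?thesis using s(1)[of y] by simp
  qed
  show "lstate (snd p) \<in> J \<and> rstate (snd p) \<in> J" if "p \<in> set fs"
    using chained_states_in[OF chain v _, of "snd p"] r that by fastforce
qed

lemma fronts_along_values_in:
  assumes fr: "fronts_along T f \<phi>b \<phi>s u t v fs"
    and "v \<in> J" "\<And>p. p \<in> set fs \<Longrightarrow> rstate (snd p) \<in> J"
  shows "\<forall>x. u t x \<in> J" "\<forall>\<^sub>F s in T. \<forall>x. u s x \<in> J"
proof -
  show "\<forall>x. u t x \<in> J" using fr step_fun_in[OF assms(2,3)] by (simp add: fronts_along_def)
  have "step_fun v (advance f (s - t) fs) x \<in> J" for s x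
    using assms(2,3) by (intro step_fun_in) (auto simp: advance_def)
  then show "\<forall>\<^sub>F s in T. \<forall>x. u s x \<in> J"
    using fr unfolding fronts_along_def by (auto elim: eventually_mono)
qed

lemma waves_at_set: "w \<in> set (waves_at fs y) \<longleftrightarrow> (y, w) \<in> set fs"
  by (force simp: waves_at_def)

context dissipative_solver begin

lemma \<phi>b_invariant:
  assumes "0 \<le> R" "a \<in> {\<phi>0 R..R}"
  shows "\<phi>b a \<in> {\<phi>0 R..R}"
proof (cases a "0 :: real" rule: linorder_cases)
  case less
  have "\<phi>0 R \<le> 0" using \<phi>0_le_iff[of R 0] assms(1) by simp
  then show ?thesis using \<phi>b_pos[OF less] dissipation_neg[OF less] \<phi>0_le_swap[of R a] assms by auto
next
  case equal
  then show ?thesis using assms \<phi>b_0 by simp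
next
  case greater
  then show ?thesis using \<phi>b_neg[OF greater] dissipation_pos[OF greater] \<phi>0_le_iff[of R a] assms by auto
qed

lemma riemann_states_in:
  assumes "0 \<le> R" "a \<in> {\<phi>0 R..R}" "b \<in> {\<phi>0 R..R}" "w \<in> set (riemann \<phi>b \<phi>s a b)"
  shows "lstate w \<in> {\<phi>0 R..R} \<and> rstate w \<in> {\<phi>0 R..R}"
  using assms(2-4) \<phi>b_invariant[OF assms(1,2)] riemann_pos[of a b] riemann_neg[of a b] riemann_zero[of b]
  by (cases a "0 :: real" rule: linorder_cases) (auto split: if_splits)

lemma evolves_outgoing_in:
  assumes R: "0 \<le> R" and rule: "interaction_rule \<phi>b \<phi>s ins outs"
    and ins: "\<And>w. w \<in> set ins \<Longrightarrow> lstate w \<in> {\<phi>0 R..R} \<and> rstate w \<in> {\<phi>0 R..R}"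
    and w: "w \<in> set outs"
  shows "rstate w \<in> {\<phi>0 R..R}"
  using rule
proof (cases "(\<phi>b, \<phi>s, ins, outs)" rule: interaction_rule.cases)
  case (3 \<phi>b' \<phi>s' w1 w2 outs')
  then show ?thesis using rule ins w riemann_states_in[OF R, of "lstate w1" "rstate w2" w] by auto
qed (use rule ins w in auto)

text \<open>
  The region is invariant under the Riemann solver because \<open>\<phi>b\<close> maps it to itself.
  Immediately before a time \<open>t\<close> the values of \<open>u\<close> are exactly the states of
  the fronts, so a bound at earlier times bounds the fronts at \<open>t\<close>, hence the outgoing
  ones, hence \<open>u\<close> at \<open>t\<close> and for some time thereafter.
\<close>

lemma front_tracking_invariant:
  assumes R: "0 \<le> R" and ft: "front_tracking f \<phi>0 \<phi>b \<phi>s \<epsilon> u0 u"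
    and init: "\<forall>x. u 0 x \<in> {\<phi>0 R..R}" and t: "0 \<le> t"
  shows "\<forall>x. u t x \<in> {\<phi>0 R..R}"
proof (rule real_time_induct[OF _ _ _ t])
  let ?J = "{\<phi>0 R..R}"
  show "\<forall>x. u 0 x \<in> ?J" by (fact init)
  obtain v fs where fr: "fronts_along (at_right 0) f \<phi>b \<phi>s u 0 v fs"
    and disc: "\<And>y. waves_at fs y \<noteq> [] \<Longrightarrow> discretization \<phi>0 \<epsilon>
         (riemann \<phi>b \<phi>s (lstate (hd (waves_at fs y))) (rstate (last (waves_at fs y)))) (waves_at fs y)"
    using ft unfolding front_tracking_def by blast
  have u0: "u 0 = step_fun v fs" and chain: "chained v (map snd fs)"
    using fr by (auto simp: fronts_along_def)
  have sorted: "sorted_wrt (\<le>) (map fst fs)"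
    by (rule fronts_along_sorted[OF fr]) (auto simp: trivial_limit_at_right_real at_le)
  have v: "v \<in> ?J" using step_fun_base_in init unfolding u0 by blast
  have "rstate (snd p) \<in> ?J" if p: "p \<in> set fs" for p
  proof -
    let ?y = "fst p"
    let ?G = "waves_at fs ?y"
    have in_G: "snd p \<in> set ?G" using p by (simp add: waves_at_set)
    then have ne: "?G \<noteq> []" by auto
    \<comment> \<open>the two outer states of the group are one-sided limits of the initial data\<close>
    have "\<forall>\<^sub>F x in at_left ?y. end_state v (map snd (filter (\<lambda>q. fst q < ?y) fs)) \<in> ?J"
      using step_fun_left[of v fs ?y] by eventually_elim (use init u0 in metis)
    then have left: "end_state v (map snd (filter (\<lambda>q. fst q < ?y) fs)) \<in> ?J"
      by (simp add: trivial_limit_at_left_real)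
    have l: "lstate (hd ?G) \<in> ?J"
      using chained_group[OF sorted chain, of ?y] left ne by (cases ?G) auto
    have "filter (\<lambda>q. fst q \<le> ?y) fs = filter (\<lambda>q. fst q < ?y) fs @ filter (\<lambda>q. fst q = ?y) fs"
      by (subst sorted_split_at[OF sorted, of ?y]) (auto simp: filter_empty_conv intro!: arg_cong2[of _ _ _ _ "(@)"] filter_cong)
    then have "step_fun v fs ?y = rstate (last ?G)"
      using ne by (simp add: step_fun_end_state end_state_def waves_at_def last_map)
    then have r: "rstate (last ?G) \<in> ?J" using init u0 by metis
    show ?thesis
      using discretization_between[OF disc[OF ne] in_G] riemann_states_in[OF R l r] by blast
  qed
  from fronts_along_values_in(2)[OF fr v this]
  show "\<forall>\<^sub>F s in at_right 0. \<forall>x. u s x \<in> ?J" .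
next
  let ?J = "{\<phi>0 R..R}"
  fix t :: real assume t: "0 < t" and before: "\<And>s. 0 \<le> s \<Longrightarrow> s < t \<Longrightarrow> \<forall>x. u s x \<in> ?J"
  obtain fs fs' where ev: "evolves_at f \<phi>b \<phi>s u t fs fs'" using ft t by (auto simp: front_tracking_def)
  then obtain v where fr: "fronts_along (at_left t) f \<phi>b \<phi>s u t v fs"
      "fronts_along (at_right t) f \<phi>b \<phi>s u t v fs'"
    and rule: "\<And>y. interaction_rule \<phi>b \<phi>s (waves_at fs y) (waves_at fs' y)"
    by (auto simp: evolves_at_def)
  have "\<forall>\<^sub>F s in at_left t. s \<in> {0<..<t}" using t by (rule eventually_at_left_real)
  then have "\<forall>\<^sub>F s in at_left t. \<forall>x. u s x \<in> ?J"
    by eventually_elim (use before in auto)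
  note ins = fronts_along_states_in[OF fr(1) trivial_limit_at_left_real this]
  have "rstate (snd p) \<in> ?J" if "p \<in> set fs'" for p
  proof (rule evolves_outgoing_in[OF R rule])
    show "snd p \<in> set (waves_at fs' (fst p))" using that by (simp add: waves_at_set)
    show "lstate w \<in> ?J \<and> rstate w \<in> ?J" if "w \<in> set (waves_at fs (fst p))" for w
      using ins(2)[of "(fst p, w)"] that by (simp add: waves_at_set)
  qed
  from fronts_along_values_in[OF fr(2) ins(1) this]
  show "(\<forall>x. u t x \<in> ?J) \<and> (\<forall>\<^sub>F s in at_right t. \<forall>x. u s x \<in> ?J)" by blast
qed

end

section \<open>Decrease of the functional\<close>

context dissipative_solver begin

lemma Q_pos_decreases:
  assumes flux: "convex_flux f R L" and R: "0 \<le> R"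
    and C: "0 < C" "C * L * R \<le> 1" "2 * C * L * R \<le> c" "0 < c"
    and gain_pos: "\<And>x y. 0 \<le> x \<Longrightarrow> x \<le> y \<Longrightarrow> y \<le> R \<Longrightarrow>
        c * (y - x) \<le> (y - \<phi>0 (\<phi>b y)) - (x - \<phi>0 (\<phi>b x))"
    and gain_neg: "\<And>y. mirrored_RC2_or_RN (waves_at fs y) (waves_at fs' y) \<Longrightarrow>
        (\<forall>x y. \<phi>0 R \<le> x \<longrightarrow> x \<le> y \<longrightarrow> y \<le> 0 \<longrightarrow>
          c * (\<phi>0 x - \<phi>0 y) \<le> (\<phi>0 x - \<phi>b x) - (\<phi>0 y - \<phi>b y))"
    and ev: "evolves_at f \<phi>b \<phi>s u t fs fs'"
    and before: "\<forall>\<^sub>F s in at_left t. \<forall>x. u s x \<in> {\<phi>0 R..R}"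
    and meet: "length (waves_at fs y0) = 2"
    and generic: "\<And>y. \<not> exceptional (waves_at fs y) (waves_at fs' y)"
  shows "\<forall>\<^sub>F s in at_left t. \<forall>\<^sub>F s' in at_right t. Q_pos f \<phi>0 C (u s') < Q_pos f \<phi>0 C (u s)"
proof -
  let ?J = "{\<phi>0 R..R}" and ?g = "pair_weight (chord f) C" and ?hat = "map (hat_pair \<phi>0)"
  obtain v where fr: "fronts_along (at_left t) f \<phi>b \<phi>s u t v fs"
      "fronts_along (at_right t) f \<phi>b \<phi>s u t v fs'"
    and rule: "\<And>y. interaction_rule \<phi>b \<phi>s (waves_at fs y) (waves_at fs' y)"
    using ev by (auto simp: evolves_at_def)
  have nontrivial: "lstate (snd p) \<noteq> rstate (snd p)" if "fronts_along T f \<phi>b \<phi>s u t v fs" "p \<in> set fs"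
    for T fs p using riemann_single_states(3)[OF fronts_along_single[OF that]] .
  have Q: "\<forall>\<^sub>F s in T. Q_pos f \<phi>0 C (u s) = potential ?g (?hat (map snd fs))"
    if fr: "fronts_along T f \<phi>b \<phi>s u t v fs" for T fs
  proof -
    have chain: "chained v (map snd fs)" using fr by (simp add: fronts_along_def)
    have "Q_pos f \<phi>0 C (u s) = potential ?g (?hat (map snd fs))"
      if s: "sorted_wrt (<) (map fst (advance f (s - t) fs))" "u s = step_fun v (advance f (s - t) fs)" for s
    proof -
      have "lstate (snd p) \<noteq> rstate (snd p)" if "p \<in> set (advance f (s - t) fs)" for p
        using that nontrivial[OF fr] by (auto simp: advance_def)
      from Q_pos_step_fun[OF s(1) _ this, of v f \<phi>0 C] show ?thesis
        using chain s(2) by (simp add: map_snd_advance)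
    qed
    then show ?thesis using fr unfolding fronts_along_def by (auto elim: eventually_mono)
  qed
  have in_J: "lstate w \<in> ?J \<and> rstate w \<in> ?J" if "(y, w) \<in> set fs" for y w
    using fronts_along_states_in(2)[OF fr(1) trivial_limit_at_left_real before that] by simp
  have in_J': "lstate w \<in> ?J \<and> rstate w \<in> ?J" if w: "(y, w) \<in> set fs'" for y w
  proof -
    have v: "v \<in> ?J" by (rule fronts_along_states_in(1)[OF fr(1) trivial_limit_at_left_real before])
    have r: "rstate w \<in> ?J" if w: "w \<in> set (map snd fs')" for w
    proof -
      obtain y where "(y, w) \<in> set fs'" using w by auto
      then show ?thesis
        using evolves_outgoing_in[OF R rule[of y], of w] in_J by (simp add: waves_at_set)
    qed
    moreover have "lstate w \<in> ?J"
      by (rule chained_states_in[OF _ v r]) (use fr(2) w in \<open>force simp: fronts_along_def\<close>)+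
    ultimately show ?thesis using w by force
  qed
  \<comment> \<open>every front is solved by itself, so its normalized states differ\<close>
  have upto: "hat_pair \<phi>0 w \<in> pairs_upto R"
    if "riemann \<phi>b \<phi>s (lstate w) (rstate w) = [w]" "lstate w \<in> ?J \<and> rstate w \<in> ?J" for w
    using that hat_single_distinct[OF that(1)] hat_nonneg hat_le_iff[OF R]
    by (auto simp: hat_pair_def pairs_upto_def)
  have in_Z: "set (?hat (waves_at fs y)) \<subseteq> pairs_upto R \<and> set (?hat (waves_at fs' y)) \<subseteq> pairs_upto R" for y
    using upto in_J in_J' fronts_along_single[OF fr(1)] fronts_along_single[OF fr(2)]
    by (fastforce simp: waves_at_set)
  have attenuates: "attenuates ?g (pairs_upto R) (?hat (waves_at fs y)) (?hat (waves_at fs' y))"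
    if two: "waves_at fs y = [w1, w2]" for y w1 w2
  proof -
    have mem: "(y, w1) \<in> set fs" "(y, w2) \<in> set fs" using two waves_at_set[of _ fs y] by auto
    note mid = colliding_speeds[OF fr(1) two]
    have outs: "waves_at fs' y = riemann \<phi>b \<phi>s (lstate w1) (rstate w2)" using rule[of y] two by simp
    have H: "hat \<phi>0 a \<le> R" if "a \<in> ?J" for a using that hat_le_iff[OF R] by simp
    show ?thesis unfolding two outs
    proof (rule collision_attenuates[OF flux C gain_pos])
      show "riemann \<phi>b \<phi>s (lstate w1) (lstate w2) = [w1]" "riemann \<phi>b \<phi>s (lstate w2) (rstate w2) = [w2]"
        using fronts_along_single[OF fr(1)] mem mid(2) by fastforce+
      show "chord f (lstate w2) (rstate w2) < chord f (lstate w1) (lstate w2)" using mid by simp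
      show "hat \<phi>0 (lstate w1) \<le> R" "hat \<phi>0 (lstate w2) \<le> R" "hat \<phi>0 (rstate w2) \<le> R"
        using in_J mem H by blast+
      show "\<not> exceptional [w1, w2] (riemann \<phi>b \<phi>s (lstate w1) (rstate w2))"
        using generic[of y] unfolding two outs .
    qed (use gain_neg[of y] in \<open>simp_all add: two outs\<close>)
  qed
  define ys where "ys = sorted_list_of_set (fst ` set fs \<union> fst ` set fs')"
  have ys: "set ys = fst ` set fs \<union> fst ` set fs'" "sorted_wrt (<) ys"
    by (auto simp: ys_def)
  have groups: "map snd fs = concat (map (waves_at fs) ys)" "map snd fs' = concat (map (waves_at fs') ys)"
    using waves_grouped[OF ys(2), of fs] waves_grouped[OF ys(2), of fs']
      fronts_along_sorted[OF fr(1)] fronts_along_sorted[OF fr(2)] ys(1)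
    by (auto simp: trivial_limit_at_left_real trivial_limit_at_right_real at_le)
  have "potential ?g (concat (map (\<lambda>y. ?hat (waves_at fs' y)) ys)) <
      potential ?g (concat (map (\<lambda>y. ?hat (waves_at fs y)) ys))"
  proof (rule potential_grouped_less[OF _ in_Z])
    show "?hat (waves_at fs y) = ?hat (waves_at fs' y) \<or>
        attenuates ?g (pairs_upto R) (?hat (waves_at fs y)) (?hat (waves_at fs' y))" for y
    proof (cases "waves_at fs y" rule: remdups_adj.cases)
      case (3 w1 w2 ws)
      then have "ws = []" using rule[of y] by (cases ws) auto
      then show ?thesis using attenuates 3 by blast
    qed (use rule[of y] in auto)
    obtain w1 w2 where two: "waves_at fs y0 = [w1, w2]" using meet by (auto simp: length_Suc_conv numeral_2_eq_2)
    then show "attenuates ?g (pairs_upto R) (?hat (waves_at fs y0)) (?hat (waves_at fs' y0))"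
      by (rule attenuates)
    have "(y0, w1) \<in> set fs" using two waves_at_set[of w1 fs y0] by simp
    then show "y0 \<in> set ys" unfolding ys by force
  qed
  then have "potential ?g (?hat (map snd fs')) < potential ?g (?hat (map snd fs))"
    unfolding groups by (simp add: map_concat comp_def)
  then show ?thesis
    using Q[OF fr(1)] Q[OF fr(2)] by (auto elim!: eventually_mono)
qed

end

section \<open>Hypotheses on flux, entropy and kinetic function\<close>

lemma concave_convex_flux_deriv:
  assumes "concave_convex_flux f"
  shows "(f has_real_derivative deriv f x) (at x)"
    and "(deriv f has_real_derivative (deriv ^^ 2) f x) (at x)"
    and "isCont ((deriv ^^ 2) f) x"
proof -
  have d: "((deriv ^^ n) f has_real_derivative (deriv ^^ Suc n) f x) (at x)" for n
    using assms by (simp add: concave_convex_flux_def smooth_def DERIV_deriv_iff_real_differentiable)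
  show "(f has_real_derivative deriv f x) (at x)" using d[of 0] by simp
  show "(deriv f has_real_derivative (deriv ^^ 2) f x) (at x)"
    using d[of 1] by (simp add: numeral_2_eq_2)
  show "isCont ((deriv ^^ 2) f) x" using d[of 2] by (rule DERIV_isCont)
qed

lemma concave_convex_flux_monotone:
  assumes "concave_convex_flux f"
  shows "0 \<le> x \<Longrightarrow> x < y \<Longrightarrow> deriv f x < deriv f y"
    and "x < y \<Longrightarrow> y \<le> 0 \<Longrightarrow> deriv f y < deriv f x"
proof -
  have sign: "0 < u * (deriv ^^ 2) f u" if "u \<noteq> 0" for u
    using assms that by (simp add: concave_convex_flux_def)
  have mv: "\<exists>z. x < z \<and> z < y \<and> deriv f y - deriv f x = (y - x) * (deriv ^^ 2) f z" if "x < y"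
    using MVT2[OF that concave_convex_flux_deriv(2)[OF assms]] by blast
  show "deriv f x < deriv f y" if "0 \<le> x" "x < y"
  proof -
    obtain z where z: "x < z" "deriv f y - deriv f x = (y - x) * (deriv ^^ 2) f z" using mv \<open>x < y\<close> by blast
    then have "0 < (deriv ^^ 2) f z" using sign[of z] that by (simp add: zero_less_mult_iff)
    then have "0 < (y - x) * (deriv ^^ 2) f z" using that by simp
    then show ?thesis using z by linarith
  qed
  show "deriv f y < deriv f x" if "x < y" "y \<le> 0"
  proof -
    obtain z where z: "z < y" "deriv f y - deriv f x = (y - x) * (deriv ^^ 2) f z" using mv \<open>x < y\<close> by blast
    then have "(deriv ^^ 2) f z < 0" using sign[of z] that by (simp add: zero_less_mult_iff)
    then have "(y - x) * (deriv ^^ 2) f z < 0" using that by (simp add: mult_less_0_iff)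
    then show ?thesis using z by linarith
  qed
qed

lemma concave_convex_imp_convex_flux:
  assumes "concave_convex_flux f"
  obtains L where "convex_flux f R L"
proof -
  have "continuous_on {0..R} ((deriv ^^ 2) f)"
    using concave_convex_flux_deriv(3)[OF assms] by (simp add: continuous_at_imp_continuous_on)
  then have "bounded ((deriv ^^ 2) f ` {0..R})"
    by (intro compact_imp_bounded compact_continuous_image) auto
  then obtain L where "0 < L" "\<And>x. x \<in> {0..R} \<Longrightarrow> norm ((deriv ^^ 2) f x) \<le> L"
    by (auto simp: bounded_pos)
  then have L: "0 \<le> L" "\<And>x. x \<in> {0..R} \<Longrightarrow> (deriv ^^ 2) f x \<le> L" by fastforce+
  have "convex_flux f R L"
  proof
    show "deriv f y - deriv f x \<le> L * (y - x)" if "0 \<le> x" "x < y" "y \<le> R" for x y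
    proof -
      obtain z where z: "x < z" "z < y" "deriv f y - deriv f x = (y - x) * (deriv ^^ 2) f z"
        using MVT2[OF \<open>x < y\<close> concave_convex_flux_deriv(2)[OF assms]] by blast
      have "(y - x) * (deriv ^^ 2) f z \<le> (y - x) * L" using L(2)[of z] z that by (intro mult_left_mono) auto
      then show ?thesis using z by (simp add: mult.commute)
    qed
  qed (use concave_convex_flux_deriv(1)[OF assms] concave_convex_flux_monotone(1)[OF assms] L in auto)
  then show ?thesis by (rule that)
qed

lemma kinetic_function_decreasing:
  assumes "kinetic_function \<phi>b" "x < y"
  shows "\<phi>b y < \<phi>b x"
proof (rule DERIV_neg_imp_decreasing[OF assms(2)])
  fix z
  show "\<exists>d. (\<phi>b has_real_derivative d) (at z) \<and> d < 0"
    using assms(1) unfolding kinetic_function_def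
    by (metis DERIV_deriv_iff_real_differentiable)
qed

lemma lower_lipschitz_gain:
  fixes h :: "real \<Rightarrow> real"
  assumes low: "lower_lipschitz_on_bounded A h" and A: "{0..R} \<subseteq> A"
    and "continuous_on {0..R} h" "h 0 = 0" "\<And>x. x \<in> {0..R} \<Longrightarrow> 0 \<le> h x"
  obtains c where "0 < c" "\<And>x y. 0 \<le> x \<Longrightarrow> x \<le> y \<Longrightarrow> y \<le> R \<Longrightarrow> c * (y - x) \<le> h y - h x"
proof -
  obtain c where c: "0 < c" "\<And>x y. x \<in> {0..R} \<Longrightarrow> y \<in> {0..R} \<Longrightarrow> c * \<bar>x - y\<bar> \<le> \<bar>h x - h y\<bar>"
    using low A unfolding lower_lipschitz_on_bounded_def by (meson bounded_closed_interval)
  show ?thesis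
    by (rule that[OF c(1)], rule expanding_nonneg_increasing[of R h c]) (use assms c in auto)
qed

theorem theorem6p1:
  fixes f U F \<phi>0 \<phi>b \<phi>s :: "real \<Rightarrow> real" and M :: real
  assumes flux: "concave_convex_flux f"
    and entropy: "entropy_pair f U F"
    and zero_diss: "zero_dissipation_function f U F \<phi>0"
    and kinetic: "kinetic_function \<phi>b"
    and dissipative: "\<And>u. u \<noteq> 0 \<Longrightarrow> \<bar>\<phi>b u\<bar> < \<bar>\<phi>0 u\<bar>"
    and lower_lipschitz: "lower_lipschitz_on_bounded UNIV (\<lambda>u. u - \<phi>0 (\<phi>b u))"
    and threshold: "threshold_function f \<phi>b \<phi>s"
  shows "\<exists>C0>0. \<forall>C. 0 < C \<and> C < C0 \<longrightarrow>
           (\<forall>u0 \<epsilon> u. bounded_variation u0 \<longrightarrow> 0 < \<epsilon> \<longrightarrow> front_tracking f \<phi>0 \<phi>b \<phi>s \<epsilon> u0 u \<longrightarrow>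
              (\<forall>x. \<bar>u 0 x\<bar> \<le> M) \<longrightarrow>
              (\<forall>t>0. \<forall>fs fs'. evolves_at f \<phi>b \<phi>s u t fs fs' \<longrightarrow>
                 (\<exists>y. length (waves_at fs y) = 2) \<longrightarrow>
                 (\<forall>y. \<not> exceptional (waves_at fs y) (waves_at fs' y)) \<longrightarrow>
                 (\<forall>y. mirrored_RC2_or_RN (waves_at fs y) (waves_at fs' y) \<longrightarrow>
                    lower_lipschitz_on_bounded {..0} (\<lambda>u. \<phi>0 u - \<phi>b u)) \<longrightarrow>
                 (\<forall>\<^sub>F s in at_left t. \<forall>\<^sub>F s' in at_right t.
                    Q_pos f \<phi>0 C (u s') < Q_pos f \<phi>0 C (u s))))"
proof -
  have \<phi>0: "\<phi>0 0 = 0" "\<And>x y. x < y \<Longrightarrow> \<phi>0 y < \<phi>0 x" "\<And>x. \<phi>0 (\<phi>0 x) = x"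
    using zero_diss by (auto simp: zero_dissipation_function_def)
  obtain K where K: "K-lipschitz_on UNIV \<phi>0"
    using zero_diss by (auto simp: zero_dissipation_function_def)
  have \<phi>b_0: "\<phi>b 0 = 0" using kinetic by (simp add: kinetic_function_def)
  have \<phi>b_cont: "continuous_on UNIV \<phi>b"
    using kinetic by (auto simp: kinetic_function_def intro: lipschitz_on_continuous_on)
  have \<phi>0_cont: "continuous_on UNIV \<phi>0" using K by (rule lipschitz_on_continuous_on)
  note \<phi>b_less = kinetic_function_decreasing[OF kinetic]
  have thr: "\<phi>s u \<noteq> u" "chord f u (\<phi>s u) = chord f u (\<phi>b u)" if "u \<noteq> 0" for u
    using threshold that unfolding threshold_function_def by (metis insertI1)+
  interpret dissipative_solver f \<phi>b \<phi>s \<phi>0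
  proof
    show "\<phi>b u < \<phi>s u \<and> \<phi>s u < u" if "0 < u" for u
      using threshold that by (simp add: threshold_function_def)
    show "u < \<phi>s u \<and> \<phi>s u < \<phi>b u" if "u < 0" for u
      using threshold that by (simp add: threshold_function_def)
    show "\<phi>0 u < \<phi>b u" if "0 < u" for u
      using dissipative[of u] \<phi>b_less[of 0 u] \<phi>0(2)[of 0 u] \<phi>0(1) \<phi>b_0 that by simp
    show "\<phi>b u < \<phi>0 u" if "u < 0" for u
      using dissipative[of u] \<phi>b_less[of u 0] \<phi>0(2)[of u 0] \<phi>0(1) \<phi>b_0 that by simp
  qed (use concave_convex_flux_deriv(1)[OF flux] concave_convex_flux_monotone[OF flux]
      \<phi>0 \<phi>b_0 \<phi>b_less thr in auto)
  \<comment> \<open>chosen such that \<open>{- M..M}\<close> lies in the invariant region \<open>{\<phi>0 R..R}\<close>\<close>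
  define R where "R = max 1 (max M (\<phi>0 (- M)))"
  have R: "0 < R" "M \<le> R" "\<phi>0 R \<le> - M"
    using \<phi>0_le_swap[of R "- M"] by (auto simp: R_def)
  obtain L where L: "convex_flux f R L" by (rule concave_convex_imp_convex_flux[OF flux])
  then have L0: "0 \<le> L" by (rule convex_flux.L_nonneg)
  obtain c1 where c1: "0 < c1" "\<And>x y. 0 \<le> x \<Longrightarrow> x \<le> y \<Longrightarrow> y \<le> R \<Longrightarrow>
      c1 * (y - x) \<le> (y - \<phi>0 (\<phi>b y)) - (x - \<phi>0 (\<phi>b x))"
  proof (rule lower_lipschitz_gain[OF lower_lipschitz, of R])
    show "continuous_on {0..R} (\<lambda>u. u - \<phi>0 (\<phi>b u))"
      by (intro continuous_intros continuous_on_compose2[OF \<phi>0_cont] continuous_on_subset[OF \<phi>b_cont]) auto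
    show "0 \<le> x - \<phi>0 (\<phi>b x)" if "x \<in> {0..R}" for x
      using that dissipation_pos[of x] \<phi>0_less_swap[of x "\<phi>b x"] \<phi>b_0 by (cases "x = 0") auto
  qed (use \<phi>b_0 in auto)
  have "\<exists>c2>0. lower_lipschitz_on_bounded {..0} (\<lambda>u. \<phi>0 u - \<phi>b u) \<longrightarrow>
      (\<forall>x y. \<phi>0 R \<le> x \<longrightarrow> x \<le> y \<longrightarrow> y \<le> 0 \<longrightarrow>
        c2 * (\<phi>0 x - \<phi>0 y) \<le> (\<phi>0 x - \<phi>b x) - (\<phi>0 y - \<phi>b y))"
  proof (cases "lower_lipschitz_on_bounded {..0} (\<lambda>u. \<phi>0 u - \<phi>b u)")
    case True
    let ?h = "\<lambda>u. \<phi>0 (- u) - \<phi>b (- u)"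
    have "lower_lipschitz_on_bounded {0..} ?h"
      unfolding lower_lipschitz_on_bounded_def
    proof (intro allI impI)
      fix S :: "real set" assume S: "S \<subseteq> {0..}" "bounded S"
      have "uminus ` S \<subseteq> {..0}" "bounded (uminus ` S)" using S by auto
      then obtain c where c: "c > 0" "\<forall>x\<in>uminus ` S. \<forall>y\<in>uminus ` S.
          c * \<bar>x - y\<bar> \<le> \<bar>(\<phi>0 x - \<phi>b x) - (\<phi>0 y - \<phi>b y)\<bar>"
        using True unfolding lower_lipschitz_on_bounded_def by blast
      then have "\<forall>x\<in>S. \<forall>y\<in>S. c * \<bar>x - y\<bar> \<le> \<bar>?h x - ?h y\<bar>" by (auto simp: abs_minus_commute)
      then show "\<exists>c>0. \<forall>x\<in>S. \<forall>y\<in>S. c * \<bar>x - y\<bar> \<le> \<bar>?h x - ?h y\<bar>" using c(1) by blast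
    qed
    then obtain c where c: "0 < c" "\<And>x y. 0 \<le> x \<Longrightarrow> x \<le> y \<Longrightarrow> y \<le> - \<phi>0 R \<Longrightarrow> c * (y - x) \<le> ?h y - ?h x"
    proof (rule lower_lipschitz_gain[of _ _ "- \<phi>0 R"])
      show "continuous_on {0..- \<phi>0 R} ?h"
        by (intro continuous_intros continuous_on_compose2[OF \<phi>0_cont] continuous_on_compose2[OF \<phi>b_cont]) auto
      show "0 \<le> ?h x" if "x \<in> {0..- \<phi>0 R}" for x
        using that dissipation_neg[of "- x"] \<phi>b_0 by (cases "x = 0") auto
    qed (use \<phi>b_0 in auto)
    \<comment> \<open>for negative states \<open>\<phi>0\<close> is the normalization, so its Lipschitz constant converts the
      bound on \<open>y - x\<close> into one on the strength \<open>\<phi>0 x - \<phi>0 y\<close> of a rarefaction\<close>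
    have K0: "0 \<le> K" using K by (rule lipschitz_on_nonneg)
    have "c / (K + 1) * (\<phi>0 x - \<phi>0 y) \<le> (\<phi>0 x - \<phi>b x) - (\<phi>0 y - \<phi>b y)"
      if "\<phi>0 R \<le> x" "x \<le> y" "y \<le> 0" for x y
    proof -
      have "\<phi>0 x - \<phi>0 y \<le> K * (y - x)"
        using lipschitz_onD[OF K, of x y] that by (simp add: dist_real_def)
      also have "\<dots> \<le> (K + 1) * (y - x)" using that by (intro mult_right_mono) auto
      finally have "c * (\<phi>0 x - \<phi>0 y) \<le> c * ((K + 1) * (y - x))" using c by (intro mult_left_mono) auto
      then have "c / (K + 1) * (\<phi>0 x - \<phi>0 y) \<le> c * (y - x)"
        using K0 by (simp add: field_simps)
      also have "\<dots> \<le> (\<phi>0 x - \<phi>b x) - (\<phi>0 y - \<phi>b y)" using c(2)[of "- y" "- x"] that by simp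
      finally show ?thesis .
    qed
    moreover have "0 < c / (K + 1)" using c K0 by simp
    ultimately show ?thesis by blast
  qed (use zero_less_one in blast)
  then obtain c2 where c2: "0 < c2" "lower_lipschitz_on_bounded {..0} (\<lambda>u. \<phi>0 u - \<phi>b u) \<Longrightarrow>
      (\<forall>x y. \<phi>0 R \<le> x \<longrightarrow> x \<le> y \<longrightarrow> y \<le> 0 \<longrightarrow>
        c2 * (\<phi>0 x - \<phi>0 y) \<le> (\<phi>0 x - \<phi>b x) - (\<phi>0 y - \<phi>b y))" by blast
  define c where "c = min c1 c2"
  have c: "0 < c" "c \<le> c1" "c \<le> c2" using c1 c2 by (auto simp: c_def)
  have gain_pos: "c * (y - x) \<le> (y - \<phi>0 (\<phi>b y)) - (x - \<phi>0 (\<phi>b x))" if "0 \<le> x" "x \<le> y" "y \<le> R" for x y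
    using c1(2)[OF that] mult_right_mono[OF c(2), of "y - x"] that by linarith
  have gain_neg: "\<forall>x y. \<phi>0 R \<le> x \<longrightarrow> x \<le> y \<longrightarrow> y \<le> 0 \<longrightarrow>
        c * (\<phi>0 x - \<phi>0 y) \<le> (\<phi>0 x - \<phi>b x) - (\<phi>0 y - \<phi>b y)"
    if "lower_lipschitz_on_bounded {..0} (\<lambda>u. \<phi>0 u - \<phi>b u)"
  proof (intro allI impI)
    fix x y assume xy: "\<phi>0 R \<le> x" "x \<le> y" "y \<le> 0"
    then have "c * (\<phi>0 x - \<phi>0 y) \<le> c2 * (\<phi>0 x - \<phi>0 y)"
      using c by (intro mult_right_mono) (auto simp: \<phi>0_le_iff)
    then show "c * (\<phi>0 x - \<phi>0 y) \<le> (\<phi>0 x - \<phi>b x) - (\<phi>0 y - \<phi>b y)"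
      using c2(2)[OF that] xy by fastforce
  qed
  \<comment> \<open>the added \<open>1\<close> only prevents a division by zero\<close>
  define C0 where "C0 = min 1 c / (2 * L * R + 1)"
  have LR: "0 \<le> L * R" using L0 R by simp
  show ?thesis
  proof (intro exI[of _ C0] conjI allI impI)
    show "0 < C0" using c LR by (simp add: C0_def)
    fix C u0 \<epsilon> u t fs fs'
    assume C: "0 < C \<and> C < C0" and ft: "front_tracking f \<phi>0 \<phi>b \<phi>s \<epsilon> u0 u"
      and init: "\<forall>x. \<bar>u 0 x\<bar> \<le> M" and t: "0 < t"
      and ev: "evolves_at f \<phi>b \<phi>s u t fs fs'" and meet: "\<exists>y. length (waves_at fs y) = 2"
      and generic: "\<forall>y. \<not> exceptional (waves_at fs y) (waves_at fs' y)"
      and low: "\<forall>y. mirrored_RC2_or_RN (waves_at fs y) (waves_at fs' y) \<longrightarrow>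
          lower_lipschitz_on_bounded {..0} (\<lambda>u. \<phi>0 u - \<phi>b u)"
    have "C * (2 * L * R + 1) < min 1 c" using C LR by (simp add: C0_def pos_less_divide_eq)
    then have "2 * (C * L * R) + C < min 1 c" by (simp add: algebra_simps)
    moreover have "0 \<le> C * L * R" using C LR by (simp add: mult.assoc)
    ultimately have C_small: "C * L * R \<le> 1" "2 * C * L * R \<le> c" using C by auto
    have init': "\<forall>x. u 0 x \<in> {\<phi>0 R..R}" using init R by (simp add: abs_le_iff) (smt (verit))
    have "\<forall>\<^sub>F s in at_left t. s \<in> {0<..<t}" using t by (rule eventually_at_left_real)
    then have before: "\<forall>\<^sub>F s in at_left t. \<forall>x. u s x \<in> {\<phi>0 R..R}"
      by eventually_elim (use front_tracking_invariant[OF _ ft init'] R in auto)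
    obtain y0 where y0: "length (waves_at fs y0) = 2" using meet by blast
    show "\<forall>\<^sub>F s in at_left t. \<forall>\<^sub>F s' in at_right t. Q_pos f \<phi>0 C (u s') < Q_pos f \<phi>0 C (u s)"
      using C R low generic gain_neg
      by (intro Q_pos_decreases[OF L _ _ C_small c(1) gain_pos _ ev before y0]) auto
  qed
qed

end
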